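(* Let $G:(0,\infty)\times S^{n-1}\to(0,\infty)$ be such that $G$ and $G_t=\partial G/\partial t$ are continuous on $(0,\infty)\times S^{n-1}$, and let $K,L\in\mathcal{S}_{c+}^n$. (i) If $\varphi_1,\varphi_2\in\mathcal{I}$ and the left derivative $(\varphi_1)'_l(1)$ exists and is positive, then $$\lim_{\varepsilon\to0^+}\frac{\widetilde{V}_G(K_\varepsilon)-\widetilde{V}_G(K)}{\varepsilon}=\frac{1}{(\varphi_1)'_l(1)}\int_{S^{n-1}}\varphi_2\!\left(\frac{\rho_L(u)}{\rho_K(u)}\right)\rho_K(u)\,G_t(\rho_K(u),u)\,du,$$ where, for $\varepsilon>0$, $K_\varepsilon$ is the star body whose radial function $\rho_\varepsilon$ is defined (implicitly and uniquely) by $$\varphi_1\left(\frac{\rho_K(u)}{\rho_\varepsilon(u)}\right)+\varepsilon\,\varphi_2\left(\frac{\rho_L(u)}{\rho_\varepsilon(u)}\right)=1,\qquad u\in S^{n-1}.$$ For $\varphi_1,\varphi_2\in\mathcal{D}$, the same formula holds when the right derivative $(\varphi_1)'_r(1)$ exists and is negative, with $(\varphi_1)'_l(1)$ replaced by $(\varphi_1)'_r(1)$. (ii) Let $a\in\mathbb{R}\cup\{-\infty\}$. If $\varphi\in\mathcal{J}_a$ and $\varphi'$ is continuous and nonzero on $(0,\infty)$, then for $g\in C(S^{n-1})$, $$\lim_{\varepsilon\to0}\frac{\widetilde{V}_G(\widehat{K}_\varepsilon)-\widetilde{V}_G(K)}{\varepsilon}=\int_{S^{n-1}}\frac{g(u)\,G_t(\rho_K(u),u)}{\varphi'(\rho_K(u))}\,du,$$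 where, for $\varepsilon\in\mathbb{R}$ close to $0$, $\widehat{K}_\varepsilon$ is the star body with radial function $\widehat{\rho}_\varepsilon(u)=\varphi^{-1}(\varphi(\rho_K(u))+\varepsilon g(u))$, $u\in S^{n-1}$.
   Context: $\mathcal{S}_{c+}^n$ is the class of star bodies in $\mathbb{R}^n$: sets $L$ that are star-shaped about the origin $o$ and whose radial function $\rho_L(u)=\sup\{\lambda>0:\lambda u\in L\}$, $u\in S^{n-1}$, is positive and continuous on $S^{n-1}$. The general dual volume is $\widetilde{V}_G(K)=\int_{S^{n-1}}G(\rho_K(u),u)\,du$, where $du=d\mathcal{H}^{n-1}(u)$. $\mathcal{I}$ is the class of continuous strictly increasing functions $\varphi:(0,\infty)\to(0,\infty)$ with $\varphi(1)=1$, $\lim_{t\to0+}\varphi(t)=0$, $\lim_{t\to\infty}\varphi(t)=\infty$; $\mathcal{D}$ is the class of continuous strictly decreasing functions $\varphi:(0,\infty)\to(0,\infty)$ with $\varphi(1)=1$, $\lim_{t\to0+}\varphi(t)=\infty$, $\lim_{t\to\infty}\varphi(t)=0$. $\mathcal{J}_a$ is the class of functions $\varphi:(0,\infty)\to(a,\infty)$ that are continuous and strictly monotonic with $\inf_{t>0}\varphi(t)=a$ and $\sup_{t>0}\varphi(t)=\infty$. *)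

theory Defs
  imports "HOL-Analysis.Analysis"
begin

section \<open>Hausdorff measure\<close>

text \<open>
  Normalised so that the \<open>k\<close>-dimensional measure agrees with Lebesgue measure on \<open>k\<close>-dimensional
  Euclidean space.  The empty set is treated separately because of \<open>0 ^ 0 = 1\<close>, which is the
  right weight for a point when \<open>k = 0\<close>.
\<close>

definition hausdorff_weight :: "nat \<Rightarrow> 'a::metric_space set \<Rightarrow> ennreal" where
  "hausdorff_weight k C =
     (if C = {} then 0 else ennreal (unit_ball_vol (real k) * (diameter C / 2) ^ k))"

definition hausdorff_content :: "nat \<Rightarrow> real \<Rightarrow> 'a::metric_space set \<Rightarrow> ennreal" where
  "hausdorff_content k \<delta> A =
     (INF C \<in> {C :: nat \<Rightarrow> 'a set. A \<subseteq> (\<Union>i. C i) \<and> (\<forall>i. bounded (C i) \<and> diameter (C i) \<le> \<delta>)}.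
        \<Sum>i. hausdorff_weight k (C i))"

definition hausdorff_outer :: "nat \<Rightarrow> 'a::metric_space set \<Rightarrow> ennreal" where
  "hausdorff_outer k A = (SUP \<delta>\<in>{0<..}. hausdorff_content k \<delta> A)"

definition hausdorff_measure :: "nat \<Rightarrow> 'a::metric_space measure" where
  "hausdorff_measure k = measure_of UNIV (sets borel) (hausdorff_outer k)"

text \<open>
  The operation \<open>measure_of\<close> returns the zero measure if its last argument is not countably additive.
  The lemma \<open>emeasure_hausdorff_measure\<close> below shows that this does not happen here.
\<close>

lemma hausdorff_weight_mono:
  assumes "C \<subseteq> D" "bounded D"
  shows "hausdorff_weight k C \<le> hausdorff_weight k D"
proof (cases "C = {}")
  case False
  have "diameter C \<le> diameter D" "0 \<le> diameter C"
    using assms by (auto intro: diameter_subset diameter_ge_0 bounded_subset)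
  then have "unit_ball_vol (real k) * (diameter C / 2) ^ k \<le> unit_ball_vol (real k) * (diameter D / 2) ^ k"
    by (intro mult_left_mono power_mono) auto
  then show ?thesis
    using False assms by (auto simp: hausdorff_weight_def intro!: ennreal_leI)
qed (simp add: hausdorff_weight_def)

lemma hausdorff_content_eq_outer_measure:
  fixes A :: "'a::metric_space set" and k :: nat
  assumes "0 < \<delta>"
  defines "f \<equiv> (\<lambda>C :: 'a set. if bounded C \<and> diameter C \<le> \<delta> then hausdorff_weight k C else \<infinity>)"
  shows "hausdorff_content k \<delta> A = outer_measure (Pow UNIV) f A"
    and "positive (Pow UNIV) f" and "increasing (Pow UNIV) f"
proof -
  show pos: "positive (Pow UNIV) f"
    using assms by (auto simp: positive_def f_def hausdorff_weight_def)
  show inc: "increasing (Pow UNIV) f"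
    unfolding increasing_def
  proof (intro ballI impI)
    fix x y :: "'a set" assume "x \<subseteq> y"
    show "f x \<le> f y"
    proof (cases "bounded y \<and> diameter y \<le> \<delta>")
      case True
      then have "bounded x" "diameter x \<le> \<delta>" "hausdorff_weight k x \<le> hausdorff_weight k y"
        using \<open>x \<subseteq> y\<close> hausdorff_weight_mono[of x y k] diameter_subset[of x y] bounded_subset[of y x]
        by linarith+
      with True show ?thesis by (simp add: f_def)
    next
      case False
      then have "f y = \<infinity>" unfolding f_def by (rule if_not_P)
      then show ?thesis by simp
    qed
  qed
  interpret ring_of_sets UNIV "Pow (UNIV :: 'a set)" 
    by (metis ring_of_sets_Pow)
  show "hausdorff_content k \<delta> A = outer_measure (Pow UNIV) f A"
  proof (rule antisym)
    show "hausdorff_content k \<delta> A \<le> outer_measure (Pow UNIV) f A"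
      unfolding outer_measure_def
    proof (safe intro!: INF_greatest)
      fix C :: "nat \<Rightarrow> 'a set" assume C: "A \<subseteq> (\<Union>i. C i)"
      show "hausdorff_content k \<delta> A \<le> (\<Sum>i. f (C i))"
      proof (cases "\<forall>i. bounded (C i) \<and> diameter (C i) \<le> \<delta>")
        case True
        then have "hausdorff_content k \<delta> A \<le> (\<Sum>i. hausdorff_weight k (C i))"
          unfolding hausdorff_content_def using C by (intro INF_lower) auto
        then show ?thesis using True by (simp add: f_def)
      next
        case False
        then obtain i where "\<not> (bounded (C i) \<and> diameter (C i) \<le> \<delta>)" by blast
        then have "f (C i) = \<infinity>" unfolding f_def by (rule if_not_P)
        then have "(\<Sum>i. f (C i)) = \<infinity>"
          using sum_le_suminf[OF summableI, of "{i}" "\<lambda>i. f (C i)"] by (simp add: top_unique)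
        then show ?thesis by simp
      qed
    qed
    show "outer_measure (Pow UNIV) f A \<le> hausdorff_content k \<delta> A"
      unfolding hausdorff_content_def
    proof (safe intro!: INF_greatest)
      fix C :: "nat \<Rightarrow> 'a set"
      assume C: "A \<subseteq> (\<Union>i. C i)" "\<forall>i. bounded (C i) \<and> diameter (C i) \<le> \<delta>"
      have "outer_measure (Pow UNIV) f A \<le> (\<Sum>i. f (C i))"
        by (intro outer_measure_le pos inc C) auto
      then show "outer_measure (Pow UNIV) f A \<le> (\<Sum>i. hausdorff_weight k (C i))"
        using C by (simp add: f_def)
    qed
  qed
qed

lemma hausdorff_content_antimono:
  "\<delta> \<le> \<delta>' \<Longrightarrow> hausdorff_content k \<delta>' A \<le> hausdorff_content k \<delta> A"
  unfolding hausdorff_content_def by (intro INF_superset_mono) (auto intro: order_trans)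

lemma outer_measure_space_hausdorff_outer:
  "outer_measure_space (Pow UNIV) (hausdorff_outer k :: 'a::metric_space set \<Rightarrow> ennreal)"
proof -
  interpret ring_of_sets UNIV "Pow (UNIV :: 'a set)" 
    by (metis ring_of_sets_Pow)
  have oms: "outer_measure_space (Pow UNIV) (hausdorff_content k \<delta> :: 'a set \<Rightarrow> ennreal)"
    if "0 < \<delta>" for \<delta>
    unfolding hausdorff_content_eq_outer_measure(1)[OF that, abs_def]
    by (intro outer_measure_space_outer_measure hausdorff_content_eq_outer_measure(2,3)[OF that])
  show ?thesis
    unfolding outer_measure_space_def
  proof (intro conjI)
    have "hausdorff_content k \<delta> ({} :: 'a set) = 0" if "0 < \<delta>" for \<delta>
      using oms[OF that] by (auto simp: outer_measure_space_def positive_def)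
    then show "positive (Pow UNIV) (hausdorff_outer k :: 'a set \<Rightarrow> ennreal)"
      by (auto simp: positive_def hausdorff_outer_def)
    show "increasing (Pow UNIV) (hausdorff_outer k :: 'a set \<Rightarrow> ennreal)"
      unfolding increasing_def hausdorff_outer_def
    proof (intro ballI impI SUP_mono')
      fix A B :: "'a set" and \<delta> :: real
      assume "A \<subseteq> B"
      then show "hausdorff_content k \<delta> A \<le> hausdorff_content k \<delta> B"
        unfolding hausdorff_content_def by (intro INF_superset_mono) auto
    qed
    show "countably_subadditive (Pow UNIV) (hausdorff_outer k :: 'a set \<Rightarrow> ennreal)"
      unfolding countably_subadditive_def
    proof (intro allI impI)
      fix A :: "nat \<Rightarrow> 'a set" assume A: "range A \<subseteq> Pow UNIV" "disjoint_family A"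
      show "hausdorff_outer k (\<Union>i. A i) \<le> (\<Sum>i. hausdorff_outer k (A i))"
        unfolding hausdorff_outer_def[of k "\<Union>i. A i"]
      proof (rule SUP_least)
        fix \<delta> :: real assume \<delta>: "\<delta> \<in> {0<..}"
        then have "hausdorff_content k \<delta> (\<Union>i. A i) \<le> (\<Sum>i. hausdorff_content k \<delta> (A i))"
          using oms[of \<delta>] A unfolding outer_measure_space_def countably_subadditive_def
          by (simp del: Pow_UNIV)
        also have "\<dots> \<le> (\<Sum>i. hausdorff_outer k (A i))"
          unfolding hausdorff_outer_def using \<delta> by (intro suminf_le summableI) (auto intro: SUP_upper)
        finally show "hausdorff_content k \<delta> (\<Union>i. A i) \<le> (\<Sum>i. hausdorff_outer k (A i))" .
      qed
    qed
  qed
qed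

lemma hausdorff_outer_add_separated:
  fixes A B :: "'a::metric_space set"
  assumes "0 < r" and sep: "\<And>x y. x \<in> A \<Longrightarrow> y \<in> B \<Longrightarrow> r \<le> dist x y"
  shows "hausdorff_outer k A + hausdorff_outer k B \<le> hausdorff_outer k (A \<union> B)"
proof -
  have key: "hausdorff_content k \<delta> A + hausdorff_content k \<delta> B \<le> hausdorff_content k \<delta> (A \<union> B)"
    if \<delta>: "0 < \<delta>" "\<delta> < r" for \<delta>
    unfolding hausdorff_content_def[of k \<delta> "A \<union> B"]
  proof (safe intro!: INF_greatest)
    fix C :: "nat \<Rightarrow> 'a set"
    assume C: "A \<union> B \<subseteq> (\<Union>i. C i)" "\<forall>i. bounded (C i) \<and> diameter (C i) \<le> \<delta>"
    define CA where "CA i = (if C i \<inter> A = {} then {} else C i)" for i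
    define CB where "CB i = (if C i \<inter> B = {} then {} else C i)" for i
    have disj: "C i \<inter> A = {} \<or> C i \<inter> B = {}" for i
    proof (rule ccontr)
      assume "\<not> ?thesis"
      then obtain x y where "x \<in> C i" "x \<in> A" "y \<in> C i" "y \<in> B" by auto
      then show False
        using sep[of x y] diameter_bounded_bound[of "C i" x y] C(2)[rule_format, of i] \<delta> by linarith
    qed
    have "hausdorff_content k \<delta> A \<le> (\<Sum>i. hausdorff_weight k (CA i))"
      unfolding hausdorff_content_def using C \<delta> by (intro INF_lower) (fastforce simp: CA_def)
    moreover have "hausdorff_content k \<delta> B \<le> (\<Sum>i. hausdorff_weight k (CB i))"
      unfolding hausdorff_content_def using C \<delta> by (intro INF_lower) (fastforce simp: CB_def)
    ultimately have "hausdorff_content k \<delta> A + hausdorff_content k \<delta> B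
        \<le> (\<Sum>i. hausdorff_weight k (CA i)) + (\<Sum>i. hausdorff_weight k (CB i))"
      by (rule add_mono)
    also have "\<dots> = (\<Sum>i. hausdorff_weight k (CA i) + hausdorff_weight k (CB i))"
      by (intro suminf_add summableI)
    also have "\<dots> \<le> (\<Sum>i. hausdorff_weight k (C i))"
    proof (intro suminf_le summableI)
      fix i show "hausdorff_weight k (CA i) + hausdorff_weight k (CB i) \<le> hausdorff_weight k (C i)"
        using disj[of i] by (auto simp: CA_def CB_def hausdorff_weight_def)
    qed
    finally show "hausdorff_content k \<delta> A + hausdorff_content k \<delta> B \<le> (\<Sum>i. hausdorff_weight k (C i))" .
  qed
  have "hausdorff_outer k A + hausdorff_outer k B
      = (SUP \<delta>\<in>{0<..}. hausdorff_content k \<delta> A + hausdorff_content k \<delta> B)"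
    unfolding hausdorff_outer_def
  proof (rule SUP_add_directed_ennreal[symmetric])
    show "\<exists>l\<in>{0<..}. hausdorff_content k i A + hausdorff_content k j B
        \<le> hausdorff_content k l A + hausdorff_content k l B"
      if "i \<in> {0<..}" "j \<in> {0<..}" for i j :: real
      using that
      by (intro bexI[of _ "min i j"] add_mono hausdorff_content_antimono) auto
  qed
  also have "\<dots> \<le> hausdorff_outer k (A \<union> B)"
  proof (rule SUP_least)
    fix \<delta> :: real assume \<delta>: "\<delta> \<in> {0<..}"
    define \<delta>' where "\<delta>' = min \<delta> (r / 2)"
    have \<delta>': "0 < \<delta>'" "\<delta>' < r" "\<delta>' \<le> \<delta>" using \<delta> \<open>0 < r\<close> by (auto simp: \<delta>'_def)
    have "hausdorff_content k \<delta> A + hausdorff_content k \<delta> B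
        \<le> hausdorff_content k \<delta>' A + hausdorff_content k \<delta>' B"
      using \<delta>' by (intro add_mono hausdorff_content_antimono)
    also have "\<dots> \<le> hausdorff_content k \<delta>' (A \<union> B)" using key \<delta>' by simp
    also have "\<dots> \<le> hausdorff_outer k (A \<union> B)"
      unfolding hausdorff_outer_def using \<delta>' by (intro SUP_upper) auto
    finally show "hausdorff_content k \<delta> A + hausdorff_content k \<delta> B \<le> hausdorff_outer k (A \<union> B)" .
  qed
  finally show ?thesis .
qed


lemma closed_in_lambda_system_hausdorff_outer:
  fixes F :: "'a::metric_space set"
  assumes "closed F"
  shows "F \<in> lambda_system UNIV (Pow UNIV) (hausdorff_outer k)"
proof (cases "F = {}")
  case True
  then show ?thesis
    using outer_measure_space_hausdorff_outer[where 'a='a and k=k]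
    by (auto simp: lambda_system_def outer_measure_space_def positive_def)
next
  case nonempty: False
  let ?H = "hausdorff_outer k :: 'a set \<Rightarrow> ennreal"
  interpret ring_of_sets UNIV "Pow (UNIV :: 'a set)"
    by (metis ring_of_sets_Pow)
  have pos: "?H {} = 0" and mono: "\<And>A B. A \<subseteq> B \<Longrightarrow> ?H A \<le> ?H B"
    and csub: "countably_subadditive (Pow UNIV) ?H"
    using outer_measure_space_hausdorff_outer[where 'a='a and k=k]
    by (auto simp: outer_measure_space_def positive_def increasing_def)
  have "subadditive (Pow UNIV) ?H"
    using outer_measure_space_hausdorff_outer[where 'a='a and k=k]
    by (intro countably_subadditive_subadditive csub) (auto simp: outer_measure_space_def)
  then have sub_disj: "?H (A \<union> B) \<le> ?H A + ?H B" if "A \<inter> B = {}" for A B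
    using that by (auto simp: subadditive_def)
  have sub: "?H (A \<union> B) \<le> ?H A + ?H B" for A B
    using sub_disj[of A "B - A"] mono[of "B - A" B]
    by (simp add: order_trans[OF _ add_left_mono])
  have main: "?H (F \<inter> A) + ?H ((UNIV - F) \<inter> A) \<le> ?H A" for A
  proof (cases "?H A = \<infinity>")
    case False
    define B where "B n = {x \<in> A. 1 / real (Suc n) \<le> infdist x F}" for n
    define S where "S j = {x \<in> A. 1 / real (Suc (Suc j)) \<le> infdist x F \<and> infdist x F < 1 / real (Suc j)}" for j
    have inf_pos: "0 < infdist x F" if "x \<notin> F" for x
      using in_closed_iff_infdist_zero[OF \<open>closed F\<close> nonempty, of x] infdist_nonneg[of x F] that by force
    have shells: "(\<Sum>j<n. ?H (S (2 * j + c))) \<le> ?H (\<Union>j<n. S (2 * j + c))" for c n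
    proof (induction n)
      case (Suc n)
      have "(\<Sum>j<Suc n. ?H (S (2 * j + c))) \<le> ?H (\<Union>j<n. S (2 * j + c)) + ?H (S (2 * n + c))"
        using Suc by (simp add: add_right_mono)
      also have "\<dots> \<le> ?H ((\<Union>j<n. S (2 * j + c)) \<union> S (2 * n + c))"
      proof (rule hausdorff_outer_add_separated)
        have "1 / real (2 * n + c + 1) < 1 / real (2 * n + c)" if "n > 0"
          using that by (intro divide_strict_left_mono) auto
        then show "(0::real) < (if n > 0 then 1 / real (2 * n + c) - 1 / real (2 * n + c + 1) else 1)"
          by (cases "n > 0") (simp_all only: if_True if_False less_diff_eq add_0 zero_less_one simp_thms)
        fix x y assume x: "x \<in> (\<Union>j<n. S (2 * j + c))" and y: "y \<in> S (2 * n + c)"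
        then obtain j where j: "j < n" "x \<in> S (2 * j + c)" by auto
        have "1 / real (2 * n + c) \<le> 1 / real (Suc (Suc (2 * j + c)))"
          using j by (intro divide_left_mono) auto
        also have "\<dots> \<le> infdist x F" using j by (simp add: S_def)
        finally have "1 / real (2 * n + c) \<le> infdist x F" .
        moreover have "infdist y F < 1 / real (2 * n + c + 1)" using y by (simp add: S_def)
        moreover have "infdist x F \<le> infdist y F + dist x y" by (rule infdist_triangle)
        ultimately show "(if n > 0 then 1 / real (2 * n + c) - 1 / real (2 * n + c + 1) else 1) \<le> dist x y"
          using j by auto
      qed
      also have "(\<Union>j<n. S (2 * j + c)) \<union> S (2 * n + c) = (\<Union>j<Suc n. S (2 * j + c))"
        by (auto simp: lessThan_Suc)
      finally show ?case .
    qed (simp add: pos)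
    have sum2: "(\<Sum>j<2 * n. g j) = (\<Sum>j<n. g (2 * j + 0)) + (\<Sum>j<n. g (2 * j + 1))"
      for g :: "nat \<Rightarrow> ennreal" and n
      by (induction n) (auto simp: algebra_simps)
    have SA: "(\<Union>j<n. S (2 * j + c)) \<subseteq> A" for n c by (auto simp: S_def)
    have "(\<Sum>j<n. ?H (S j)) \<le> 2 * ?H A" for n
    proof -
      have "(\<Sum>j<n. ?H (S j)) \<le> (\<Sum>j<2 * n. ?H (S j))"
        by (intro sum_mono2) auto
      also have "\<dots> \<le> ?H A + ?H A"
        unfolding sum2 by (intro add_mono order_trans[OF shells] mono SA)
      finally show ?thesis by (simp add: mult_2)
    qed
    then have "(\<Sum>j. ?H (S j)) \<le> 2 * ?H A"
      by (intro suminf_le_const summableI)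
    also have "\<dots> < \<infinity>" using False by (simp add: ennreal_mult_less_top less_top)
    finally have fin: "(\<Sum>j. ?H (S j)) \<noteq> \<infinity>" by simp
    have bound: "?H (F \<inter> A) + ?H ((UNIV - F) \<inter> A) \<le> ?H A + (\<Sum>j. ?H (S (j + n)))" for n
    proof -
      have cover: "(UNIV - F) \<inter> A \<subseteq> B n \<union> (\<Union>j. S (j + n))"
      proof
        fix x assume x: "x \<in> (UNIV - F) \<inter> A"
        then have p: "0 < infdist x F" using inf_pos by auto
        show "x \<in> B n \<union> (\<Union>j. S (j + n))"
        proof (cases "x \<in> B n")
          case nB: False
          obtain m0 where m0: "1 / real (Suc m0) < infdist x F"
            using p reals_Archimedean by (auto simp: inverse_eq_divide)
          define m where "m = (LEAST m. 1 / real (Suc m) \<le> infdist x F)"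
          have m: "1 / real (Suc m) \<le> infdist x F"
            unfolding m_def by (rule LeastI[of _ m0]) (use m0 in simp)
          have least: "infdist x F < 1 / real (Suc i)" if "i < m" for i
            using not_less_Least[of i "\<lambda>m. 1 / real (Suc m) \<le> infdist x F"] that by (simp add: m_def)
          have "n < m"
          proof (rule ccontr)
            assume "\<not> n < m"
            then have "1 / real (Suc n) \<le> 1 / real (Suc m)" by (intro divide_left_mono) auto
            then show False using nB m x by (auto simp: B_def)
          qed
          then obtain j where j: "m = Suc (j + n)"
            by (metis add.commute less_iff_Suc_add)
          then have "x \<in> S (j + n)" using m least[of "j + n"] x by (auto simp: S_def)
          then show ?thesis by auto
        qed auto
      qed
      have union: "?H (\<Union>j. S (j + n)) \<le> (\<Sum>j. ?H (S (j + n)))"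
      proof -
        have "disjoint_family (\<lambda>j. S (j + n))"
          unfolding disjoint_family_on_def
        proof (intro ballI impI)
          fix i j :: nat assume "i \<noteq> j"
          have *: "S a \<inter> S b = {}" if "a < b" for a b
          proof -
            have "1 / real (Suc b) \<le> 1 / real (Suc (Suc a))"
              using that by (intro divide_left_mono) auto
            then show ?thesis by (auto simp: S_def)
          qed
          show "S (i + n) \<inter> S (j + n) = {}"
            using \<open>i \<noteq> j\<close> *[of "i + n" "j + n"] *[of "j + n" "i + n"] by (cases "i < j") auto
        qed
        then show ?thesis using csub by (auto simp: countably_subadditive_def)
      qed
      have sep: "?H (F \<inter> A) + ?H (B n) \<le> ?H A"
      proof -
        have "?H (F \<inter> A) + ?H (B n) \<le> ?H ((F \<inter> A) \<union> B n)"
        proof (rule hausdorff_outer_add_separated)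
          show "0 < 1 / real (Suc n)" by simp
          fix x y assume "x \<in> F \<inter> A" "y \<in> B n"
          then show "1 / real (Suc n) \<le> dist x y"
            using infdist_le[of x F y] by (auto simp: B_def dist_commute)
        qed
        also have "\<dots> \<le> ?H A" by (rule mono) (auto simp: B_def)
        finally show ?thesis .
      qed
      have "?H ((UNIV - F) \<inter> A) \<le> ?H (B n) + (\<Sum>j. ?H (S (j + n)))"
        by (rule order_trans[OF mono[OF cover]], rule order_trans[OF sub], intro add_mono union order_refl)
      then have "?H (F \<inter> A) + ?H ((UNIV - F) \<inter> A) \<le> ?H (F \<inter> A) + (?H (B n) + (\<Sum>j. ?H (S (j + n))))"
        by (rule add_left_mono)
      also have "\<dots> \<le> ?H A + (\<Sum>j. ?H (S (j + n)))"
        using sep by (simp add: add.assoc[symmetric] add_right_mono)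
      finally show ?thesis .
    qed
    have "(\<lambda>n. \<Sum>j. ?H (S (j + n))) \<longlonglongrightarrow> 0"
    proof -
      define h where "h j = enn2real (?H (S j))" for j
      have Hfin: "?H (S j) \<noteq> \<infinity>" for j
        using fin sum_le_suminf[OF summableI, of "{j}" "\<lambda>j. ?H (S j)"] by (auto simp: top_unique)
      then have h: "?H (S j) = ennreal (h j)" and hn: "0 \<le> h j" for j
        by (auto simp: h_def less_top)
      have sm: "summable h"
        using fin hn by (intro summable_suminf_not_top) (auto simp: h)
      have "(\<lambda>n. \<Sum>j. h (j + n)) \<longlonglongrightarrow> 0"
        by (rule suminf_exist_split2[OF sm])
      then have "(\<lambda>n. ennreal (\<Sum>j. h (j + n))) \<longlonglongrightarrow> ennreal 0"
        by (rule tendsto_ennrealI)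
      moreover have "ennreal (\<Sum>j. h (j + n)) = (\<Sum>j. ?H (S (j + n)))" for n
        unfolding h using hn sm by (intro suminf_ennreal2[symmetric]) auto
      ultimately show ?thesis by simp
    qed
    then have "(\<lambda>n. ?H A + (\<Sum>j. ?H (S (j + n)))) \<longlonglongrightarrow> ?H A + 0"
      by (intro tendsto_add tendsto_const)
    then show ?thesis
      using bound by (intro LIMSEQ_le_const[of _ "?H A"]) auto
  qed simp
  have "?H A \<le> ?H (F \<inter> A) + ?H ((UNIV - F) \<inter> A)" for A
    by (rule order_trans[OF mono sub]) auto
  with main have "?H (F \<inter> A) + ?H ((UNIV - F) \<inter> A) = ?H A" for A
    by (intro antisym)
  then show ?thesis unfolding lambda_system_def by simp
qed

lemma emeasure_hausdorff_measure:
  fixes A :: "'a::metric_space set"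
  assumes "A \<in> sets borel"
  shows "emeasure (hausdorff_measure k) A = hausdorff_outer k A"
proof -
  let ?L = "lambda_system UNIV (Pow UNIV) (hausdorff_outer k :: 'a set \<Rightarrow> ennreal)"
  interpret sigma_algebra UNIV "Pow (UNIV :: 'a set)" by (rule sigma_algebra_Pow)
  have ms: "measure_space UNIV ?L (hausdorff_outer k)"
    by (rule caratheodory_lemma[OF outer_measure_space_hausdorff_outer])
  then interpret L: sigma_algebra UNIV ?L by (simp add: measure_space_def)
  have "sigma_sets UNIV (Collect closed) \<subseteq> ?L"
    by (rule L.sigma_sets_subset) (use closed_in_lambda_system_hausdorff_outer in blast)
  then have "sets borel \<subseteq> ?L"
    unfolding borel_eq_closed by (subst sets_measure_of) simp_all
  then have "measure_space UNIV (sets borel) (hausdorff_outer k :: 'a set \<Rightarrow> ennreal)"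
    using measure_down[OF ms] sets.sigma_algebra_axioms[of borel] by simp
  then show ?thesis
    unfolding hausdorff_measure_def measure_space_def
    using emeasure_measure_of_sigma[OF _ _ _ assms] by blast
qed

lemma sets_hausdorff_measure [simp, measurable_cong]: "sets (hausdorff_measure k) = sets borel"
  unfolding hausdorff_measure_def
  using sets.sigma_sets_eq[of borel] by (simp add: sets_measure_of_conv)

lemma space_hausdorff_measure [simp]: "space (hausdorff_measure k) = UNIV"
  by (simp add: hausdorff_measure_def space_measure_of_conv)


section \<open>Star bodies and the general dual volume\<close>

definition radial_function :: "(real ^ 'n) set \<Rightarrow> real ^ 'n \<Rightarrow> real" where
  "radial_function L u = Sup {l. 0 < l \<and> l *\<^sub>R u \<in> L}"

text \<open>
  The supremum of a set of reals is a junk value unless the set is nonempty and bounded above, so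
  this is required explicitly; it is implicit in the radial function being positive and real-valued.
\<close>

definition star_bodies :: "(real ^ 'n) set set" where
  "star_bodies = {L.
     0 \<in> L \<and> (\<forall>x\<in>L. closed_segment 0 x \<subseteq> L) \<and>
     (\<forall>u\<in>sphere 0 1. {l. 0 < l \<and> l *\<^sub>R u \<in> L} \<noteq> {} \<and> bdd_above {l. 0 < l \<and> l *\<^sub>R u \<in> L}) \<and>
     (\<forall>u\<in>sphere 0 1. 0 < radial_function L u) \<and>
     continuous_on (sphere 0 1) (radial_function L)}"

definition dual_volume :: "(real \<Rightarrow> real ^ 'n \<Rightarrow> real) \<Rightarrow> (real ^ 'n) set \<Rightarrow> real" where
  "dual_volume G K =
     (LINT u:sphere 0 1|hausdorff_measure (CARD('n) - 1). G (radial_function K u) u)"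

section \<open>Orlicz functions\<close>

text \<open>Functions on \<open>(0, \<infinity>)\<close> are total functions on the reals, used only at positive arguments.\<close>

definition orlicz_I :: "(real \<Rightarrow> real) set" where
  "orlicz_I = {\<phi>. (\<forall>t>0. 0 < \<phi> t) \<and> continuous_on {0<..} \<phi> \<and> strict_mono_on {0<..} \<phi> \<and>
     \<phi> 1 = 1 \<and> (\<phi> \<longlongrightarrow> 0) (at_right 0) \<and> filterlim \<phi> at_top at_top}"

definition orlicz_D :: "(real \<Rightarrow> real) set" where
  "orlicz_D = {\<phi>. (\<forall>t>0. 0 < \<phi> t) \<and> continuous_on {0<..} \<phi> \<and> strict_antimono_on {0<..} \<phi> \<and>
     \<phi> 1 = 1 \<and> filterlim \<phi> at_top (at_right 0) \<and> (\<phi> \<longlongrightarrow> 0) at_top}"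

definition orlicz_J :: "ereal \<Rightarrow> (real \<Rightarrow> real) set" where
  "orlicz_J a = {\<phi>. (\<forall>t>0. a < ereal (\<phi> t)) \<and> continuous_on {0<..} \<phi> \<and>
     (strict_mono_on {0<..} \<phi> \<or> strict_antimono_on {0<..} \<phi>) \<and>
     (INF t\<in>{0<..}. ereal (\<phi> t)) = a \<and> (SUP t\<in>{0<..}. ereal (\<phi> t)) = \<infinity>}"

section \<open>Perturbations of a star body\<close>

text \<open>
  The radial function determines a star-shaped set only up to its radial boundary points, so the
  perturbed bodies are described by predicates.
\<close>

definition orlicz_equation ::
  "(real \<Rightarrow> real) \<Rightarrow> (real \<Rightarrow> real) \<Rightarrow> real \<Rightarrow> (real ^ 'n) set \<Rightarrow> (real ^ 'n) set \<Rightarrow> real ^ 'n \<Rightarrow> real \<Rightarrow> bool"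
where
  "orlicz_equation \<phi>1 \<phi>2 \<epsilon> K L u r \<longleftrightarrow>
     \<phi>1 (radial_function K u / r) + \<epsilon> * \<phi>2 (radial_function L u / r) = 1"

definition is_orlicz_combination ::
  "(real \<Rightarrow> real) \<Rightarrow> (real \<Rightarrow> real) \<Rightarrow> real \<Rightarrow> (real ^ 'n) set \<Rightarrow> (real ^ 'n) set \<Rightarrow> (real ^ 'n) set \<Rightarrow> bool"
where
  "is_orlicz_combination \<phi>1 \<phi>2 \<epsilon> K L M \<longleftrightarrow>
     M \<in> star_bodies \<and> (\<forall>u\<in>sphere 0 1. orlicz_equation \<phi>1 \<phi>2 \<epsilon> K L u (radial_function M u))"

definition is_phi_perturbation ::
  "(real \<Rightarrow> real) \<Rightarrow> (real ^ 'n \<Rightarrow> real) \<Rightarrow> real \<Rightarrow> (real ^ 'n) set \<Rightarrow> (real ^ 'n) set \<Rightarrow> bool"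
where
  "is_phi_perturbation \<phi> g \<epsilon> K M \<longleftrightarrow>
     M \<in> star_bodies \<and>
     (\<forall>u\<in>sphere 0 1.
        radial_function M u = the_inv_into {0<..} \<phi> (\<phi> (radial_function K u) + \<epsilon> * g u))"

end

theory Submission
  imports Defs
begin

text \<open>
  Every family of bodies in the theorem has radial functions \<open>\<rho>\<^sub>\<epsilon>\<close> that are differentiable in \<open>\<epsilon>\<close> at \<open>0\<close>
  in each direction, with \<open>\<bar>\<rho>\<^sub>\<epsilon> - \<rho>\<^sub>K\<bar> \<le> C * \<bar>\<epsilon>\<bar>\<close> uniformly on the sphere for small \<open>\<epsilon>\<close>.  The dual volume may then be
  differentiated under the integral sign: the difference quotients of \<open>G (\<rho>\<^sub>\<epsilon>(u)) u\<close> converge by the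
  chain rule and are bounded by the mean value theorem (\<open>dual_volume_first_variation\<close>).  Dominated
  convergence needs that constants are integrable, that is, that the unit sphere has finite
  \<open>(n - 1)\<close>-dimensional Hausdorff measure.  The lemma \<open>emeasure_sphere_hausdorff_finite\<close> proves this by
  comparing volumes: at most a constant times \<open>r ^ -(n - 1)\<close> disjoint balls of radius \<open>r\<close> can be centred on
  the sphere, as they fill a shell of thickness \<open>2 * r\<close>.

  It remains to know the radii.  For an Orlicz combination, the equation for \<open>x = \<rho>\<^sub>K / \<rho>\<^sub>\<epsilon>\<close> reads
  \<open>\<phi>1 x + \<epsilon> * \<phi>2 (q * x) = 1\<close> with \<open>q = \<rho>\<^sub>L / \<rho>\<^sub>K\<close>, an equation between numbers.  For increasing functions its
  root is unique by monotonicity, lies below \<open>1\<close>, and satisfies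
  \<open>(x - 1) / \<epsilon> = - \<phi>2 (q * x) / ((\<phi>1 x - 1) / (x - 1))\<close>, which tends to \<open>- \<phi>2 q / d\<close>
  (\<open>solution_branch_exists_I\<close>).  Decreasing functions become increasing
  under \<open>t \<mapsto> 1 / t\<close> (\<open>solution_branch_exists_D\<close>).  In the second part the radii are given explicitly by the
  inverse of \<open>\<phi>\<close>, whose derivative is \<open>1 / \<phi>'\<close> (\<open>dual_volume_phi_variation\<close>).
\<close>

section \<open>The unit sphere has finite Hausdorff measure\<close>

text \<open>
  A packing argument: the balls of radius \<open>r\<close> about the points of \<open>T\<close> are disjoint and lie in the shell
  between the spheres of radius \<open>1 - r\<close> and \<open>1 + r\<close>.  The volume of the shell is of order \<open>r\<close> and that
  of each ball is of order \<open>r ^ DIM('a)\<close>.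
\<close>

lemma card_separated_in_sphere_le:
  fixes T :: "'a::euclidean_space set"
  assumes T: "finite T" "T \<subseteq> sphere 0 1"
    and sep: "pairwise (\<lambda>x y. 2 * r \<le> dist x y) T"
    and r: "0 < r" "r \<le> 1"
  shows "real (card T) * r ^ (DIM('a) - 1) \<le> 2 ^ DIM('a) * real DIM('a)"
proof -
  let ?n = "DIM('a)" and ?v = "unit_ball_vol (real DIM('a))"
  let ?U = "\<Union>x\<in>T. ball x r" and ?B = "ball (0::'a) (1 - r)"
  have disj: "disjoint_family_on (\<lambda>x. ball x r) T"
    unfolding disjoint_family_on_def
  proof (intro ballI impI)
    fix x y assume "x \<in> T" "y \<in> T" "x \<noteq> y"
    then have "2 * r \<le> dist x y" using sep by (auto simp: pairwise_def)
    then show "ball x r \<inter> ball y r = {}" by (intro disjoint_ballI) simp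
  qed
  have ball_fin: "emeasure lborel (ball x \<rho>) < top" for x :: 'a and \<rho>
    using emeasure_bounded_finite[OF bounded_ball, of x \<rho>] by simp
  have U: "measure lborel ?U = card T * (?v * r ^ ?n)"
    using T disj r ball_fin[THEN less_imp_neq]
    by (subst measure_finite_Union) (auto simp: content_ball)
  have "emeasure lborel ?U \<le> (\<Sum>x\<in>T. emeasure lborel (ball x r))"
    using T by (intro emeasure_subadditive_finite) auto
  also have "\<dots> < \<infinity>"
    using T ball_fin by simp
  finally have U_fin: "emeasure lborel ?U < \<infinity>" .
  then have U_neq: "emeasure lborel ?U \<noteq> top" by simp
  have "?U \<inter> ?B = {}"
  proof (rule ccontr)
    assume "?U \<inter> ?B \<noteq> {}"
    then obtain x y where "x \<in> T" "dist x y < r" "norm y < 1 - r" by auto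
    with T show False using norm_triangle_ineq2[of x y] by (auto simp: dist_norm)
  qed
  then have "measure lborel ?U + measure lborel ?B = measure lborel (?U \<union> ?B)"
    using T U_neq ball_fin[THEN less_imp_neq] by (intro measure_Union[symmetric]) auto
  also have "\<dots> \<le> measure lborel (ball (0::'a) (1 + r))"
  proof (rule measure_mono_fmeasurable)
    show "?U \<union> ?B \<in> sets lborel" by (simp add: borel_open open_UN open_Un)
    show "?U \<union> ?B \<subseteq> ball 0 (1 + r)"
    proof
      fix y assume "y \<in> ?U \<union> ?B"
      then consider x where "x \<in> T" "dist x y < r" | "norm y < 1 - r" by auto
      then show "y \<in> ball 0 (1 + r)"
      proof cases
        case 1
        with T show ?thesis using norm_triangle_ineq2[of y x] by (auto simp: dist_norm norm_minus_commute)
      qed (use r in auto)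
    qed
  qed (auto simp: ball_fin fmeasurable_def)
  finally have "card T * (?v * r ^ ?n) + ?v * (1 - r) ^ ?n \<le> ?v * (1 + r) ^ ?n"
    using r unfolding U by (simp add: content_ball)
  then have "?v * (card T * r ^ ?n) \<le> ?v * ((1 + r) ^ ?n - (1 - r) ^ ?n)"
    by (simp add: algebra_simps)
  then have "card T * r ^ ?n \<le> (1 + r) ^ ?n - (1 - r) ^ ?n"
    by (simp add: unit_ball_vol_pos)
  also have "\<dots> = 2 * r * (\<Sum>i<?n. (1 - r) ^ (?n - Suc i) * (1 + r) ^ i)"
    using power_diff_sumr2[of "1 + r" ?n "1 - r"] by simp
  \<comment> \<open>Each of the \<open>?n\<close> terms is bounded using \<open>1 - r \<le> 1\<close> and \<open>1 + r \<le> 2\<close>.\<close>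
  also have "\<dots> \<le> 2 * r * (\<Sum>i<?n. 1 * 2 ^ (?n - 1))"
  proof (intro mult_left_mono sum_mono mult_mono power_le_one)
    fix i assume "i \<in> {..<?n}"
    then have "(1 + r) ^ i \<le> 2 ^ i" "(2::real) ^ i \<le> 2 ^ (?n - 1)"
      using r by (auto intro!: power_mono power_increasing)
    then show "(1 + r) ^ i \<le> 2 ^ (?n - 1)" by linarith
  qed (use r in auto)
  also have "\<dots> = r * (2 ^ ?n * real ?n)"
    using DIM_positive[where 'a='a] power_minus_mult[of ?n "2::real"] by (simp add: mult.commute)
  finally have "card T * r ^ ?n \<le> r * (2 ^ ?n * real ?n)" .
  moreover have r_pow: "r ^ ?n = r * r ^ (?n - 1)"
    using DIM_positive[where 'a='a] power_minus_mult[of ?n r] by (simp add: mult.commute)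
  ultimately have "r * (real (card T) * r ^ (?n - 1)) \<le> r * (2 ^ ?n * real ?n)"
    unfolding r_pow by (simp only: mult_ac)
  then show ?thesis using r by simp
qed

text \<open>
  A \<open>2 * r\<close>-separated subset of the sphere with the largest possible number of points is a
  \<open>2 * r\<close>-net: a point that it misses could be added to it.
\<close>

lemma exists_finite_net_of_sphere:
  assumes r: "0 < r" "r \<le> 1"
  obtains T :: "'a::euclidean_space set" where "finite T" "T \<subseteq> sphere 0 1"
    "sphere 0 1 \<subseteq> (\<Union>x\<in>T. cball x (2 * r))"
    "real (card T) * r ^ (DIM('a) - 1) \<le> 2 ^ DIM('a) * real DIM('a)"
proof -
  define P :: "'a set \<Rightarrow> bool"
    where "P T \<longleftrightarrow> finite T \<and> T \<subseteq> sphere 0 1 \<and> pairwise (\<lambda>x y. 2 * r \<le> dist x y) T" for T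
  have bound: "real (card T) * r ^ (DIM('a) - 1) \<le> 2 ^ DIM('a) * real DIM('a)" if "P T" for T
    using that r by (intro card_separated_in_sphere_le) (auto simp: P_def)
  obtain b :: nat where b: "2 ^ DIM('a) * real DIM('a) / r ^ (DIM('a) - 1) < b"
    using reals_Archimedean2 by blast
  have "card T < b" if "P T" for T
  proof -
    have "real (card T) \<le> 2 ^ DIM('a) * real DIM('a) / r ^ (DIM('a) - 1)"
      using bound[OF that] r by (simp add: pos_le_divide_eq)
    with b show ?thesis by linarith
  qed
  moreover have "P {}" by (simp add: P_def)
  ultimately obtain T where T: "P T" and max: "\<And>T'. P T' \<Longrightarrow> card T' \<le> card T"
    using ex_has_greatest_nat[of P "{}" card b] by blast
  have "x \<in> (\<Union>t\<in>T. cball t (2 * r))" if x: "x \<in> sphere 0 1" for x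
  proof (rule ccontr)
    assume far: "x \<notin> (\<Union>t\<in>T. cball t (2 * r))"
    then have "P (insert x T)"
      using T x by (force simp: P_def pairwise_insert dist_commute)
    moreover have "x \<notin> T" using far r by force
    ultimately show False using max[of "insert x T"] T by (simp add: P_def)
  qed
  then show ?thesis using T bound[OF T] that[of T] unfolding P_def by blast
qed

text \<open>
  The balls about the points of a net have diameter \<open>4 * r\<close>, so their total weight is the number of
  points times \<open>r ^ (DIM('a) - 1)\<close>, up to a constant.  The packing bound makes this independent of \<open>r\<close>.
\<close>

lemma emeasure_sphere_hausdorff_finite:
  "emeasure (hausdorff_measure (DIM('a) - 1)) (sphere (0::'a::euclidean_space) 1) < \<infinity>"
proof -
  let ?k = "DIM('a) - 1"
  let ?B = "unit_ball_vol (real ?k) * (2 ^ ?k * (2 ^ DIM('a) * real DIM('a)))"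
  have "hausdorff_content ?k \<delta> (sphere (0::'a) 1) \<le> ennreal ?B" if "0 < \<delta>" for \<delta>
  proof -
    \<comment> \<open>The balls of the net have radius \<open>2 * r\<close>, hence diameter at most \<open>\<delta>\<close>.\<close>
    define r where "r = min 1 (\<delta> / 4)"
    have r: "0 < r" "r \<le> 1" "4 * r \<le> \<delta>" using that by (auto simp: r_def)
    obtain T :: "'a set" where T: "finite T" "sphere 0 1 \<subseteq> (\<Union>x\<in>T. cball x (2 * r))"
        "real (card T) * r ^ ?k \<le> 2 ^ DIM('a) * real DIM('a)"
      using exists_finite_net_of_sphere[OF r(1,2)] by metis
    obtain xs where xs: "set xs = T" "distinct xs" using finite_distinct_list[OF T(1)] by blast
    define C where "C i = (if i < length xs then cball (xs ! i) (2 * r) else {})" for i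
    have "sphere 0 1 \<subseteq> (\<Union>i. C i)"
    proof
      fix y :: 'a assume "y \<in> sphere 0 1"
      then obtain x where "x \<in> T" "y \<in> cball x (2 * r)" using T by blast
      then obtain i where "i < length xs" "y \<in> cball (xs ! i) (2 * r)"
        using xs by (auto simp: in_set_conv_nth)
      then have "y \<in> C i" by (simp add: C_def)
      then show "y \<in> (\<Union>i. C i)" by blast
    qed
    moreover have "bounded (C i) \<and> diameter (C i) \<le> \<delta>" for i
      using r that by (auto simp: C_def)
    ultimately have "hausdorff_content ?k \<delta> (sphere (0::'a) 1) \<le> (\<Sum>i. hausdorff_weight ?k (C i))"
      unfolding hausdorff_content_def by (intro INF_lower) auto
    also have "\<dots> = (\<Sum>i<length xs. hausdorff_weight ?k (C i))"
      by (rule suminf_finite) (auto simp: C_def hausdorff_weight_def)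
    also have "\<dots> = (\<Sum>i<length xs. ennreal (unit_ball_vol (real ?k) * (2 * r) ^ ?k))"
      using r by (intro sum.cong) (auto simp: C_def hausdorff_weight_def)
    also have "\<dots> = ennreal (unit_ball_vol (real ?k) * (2 ^ ?k * (real (card T) * r ^ ?k)))"
      using r xs distinct_card[OF xs(2)]
      by (simp add: ennreal_of_nat_eq_real_of_nat ennreal_mult'[symmetric] power_mult_distrib mult_ac)
    also have "\<dots> \<le> ennreal ?B"
      using T(3) by (intro ennreal_leI mult_left_mono) auto
    finally show ?thesis .
  qed
  then have "hausdorff_outer ?k (sphere (0::'a) 1) \<le> ennreal ?B"
    unfolding hausdorff_outer_def by (intro SUP_least) auto
  then show ?thesis
    by (simp add: emeasure_hausdorff_measure order_le_less_trans)
qed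

section \<open>Radial functions of star bodies\<close>

lemma star_body_radial_bounds:
  assumes "K \<in> star_bodies"
  obtains m R where "0 < m" "m \<le> R" "\<And>u. u \<in> sphere 0 1 \<Longrightarrow> m \<le> radial_function K u"
    "\<And>u. u \<in> sphere 0 1 \<Longrightarrow> radial_function K u \<le> R"
proof -
  have c: "continuous_on (sphere 0 1) (radial_function K)"
    and pos: "\<forall>u\<in>sphere 0 1. 0 < radial_function K u"
    using assms by (auto simp: star_bodies_def)
  have ne: "sphere (0::real ^ 'a) 1 \<noteq> {}" by simp
  obtain u v where "u \<in> sphere 0 1" "\<forall>w\<in>sphere 0 1. radial_function K u \<le> radial_function K w"
     "v \<in> sphere 0 1" "\<forall>w\<in>sphere 0 1. radial_function K w \<le> radial_function K v"
    using continuous_attains_inf[OF compact_sphere ne c] continuous_attains_sup[OF compact_sphere ne c]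
    by blast
  then show ?thesis using pos that[of "radial_function K u" "radial_function K v"] by blast
qed

text \<open>
  Radial functions of star bodies are exactly the positive continuous functions on the sphere, so a
  perturbed body exists as soon as its prescribed radial function is positive and continuous.
\<close>

lemma exists_star_body_with_radial_function:
  fixes f :: "real ^ 'n \<Rightarrow> real"
  assumes f: "continuous_on (sphere 0 1) f" "\<And>u. u \<in> sphere 0 1 \<Longrightarrow> 0 < f u"
  shows "\<exists>M\<in>star_bodies. \<forall>u\<in>sphere 0 1. radial_function M u = f u"
proof -
  define M where "M = {x. x = 0 \<or> norm x \<le> f (x /\<^sub>R norm x)}"
  have ray: "{l. 0 < l \<and> l *\<^sub>R u \<in> M} = {0<..f u}" if "u \<in> sphere 0 1" for u
    using that by (auto simp: M_def)
  have rad: "radial_function M u = f u" if "u \<in> sphere 0 1" for u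
    using f(2)[OF that] by (simp add: radial_function_def ray[OF that])
  have zero_in: "0 \<in> M" by (simp add: M_def)
  have "closed_segment 0 x \<subseteq> M" if "x \<in> M" for x
  proof
    fix y assume "y \<in> closed_segment 0 x"
    then obtain t where t: "0 \<le> t" "t \<le> 1" "y = t *\<^sub>R x" by (auto simp: in_segment)
    show "y \<in> M"
    proof (cases "y = 0")
      case False
      then have "norm x \<le> f (x /\<^sub>R norm x)" using \<open>x \<in> M\<close> t by (auto simp: M_def)
      moreover have "norm y \<le> norm x" using t by (simp add: mult_left_le_one_le)
      moreover have "y /\<^sub>R norm y = x /\<^sub>R norm x" using t False by simp
      ultimately have "norm y \<le> f (y /\<^sub>R norm y)" by (metis order_trans)
      then show ?thesis by (simp add: M_def)
    qed (simp add: M_def)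
  qed
  moreover have "continuous_on (sphere 0 1) (radial_function M)"
    using f(1) by (rule continuous_on_eq) (simp add: rad)
  ultimately have "M \<in> star_bodies"
    using f(2) zero_in unfolding star_bodies_def mem_Collect_eq
    by (intro conjI ballI) (simp_all only: ray rad bdd_above_Ioc greaterThanAtMost_empty_iff not_le simp_thms)
  then show ?thesis using rad by blast
qed

section \<open>Differentiation under the integral sign\<close>

lemma integrable_on_sphere:
  fixes f :: "real ^ 'n \<Rightarrow> real"
  assumes "continuous_on (sphere 0 1) f"
  shows "set_integrable (hausdorff_measure (CARD('n) - 1)) (sphere 0 1) f"
proof -
  have "bounded (f ` sphere 0 1)"
    using assms by (intro compact_imp_bounded compact_continuous_image) auto
  then obtain B where B: "\<forall>u\<in>sphere 0 1. \<bar>f u\<bar> \<le> B"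
    by (auto simp: bounded_iff)
  have "(\<lambda>u. indicator (sphere 0 1) u *\<^sub>R f u) \<in> borel_measurable (hausdorff_measure (CARD('n) - 1))"
    using borel_measurable_continuous_on_indicator[OF _ assms]
    by (simp cong: measurable_cong_sets)
  then show ?thesis
    unfolding set_integrable_def
    using B emeasure_sphere_hausdorff_finite[where 'a="real ^ 'n"]
    by (intro integrableI_bounded_set[where A="sphere 0 1" and B=B]) (auto simp: indicator_def)
qed

text \<open>
  The analytic core of both parts.  By the chain rule the difference quotients of the integrand
  converge pointwise to \<open>h u * Gt (\<rho> u) u\<close>.  The uniform Lipschitz bound keeps all radii
  in one compact interval of positive numbers, where \<open>Gt\<close> is bounded; by the mean value theorem the
  quotients are then bounded, and a constant is integrable because the sphere has finite measure.
  The set \<open>S\<close> allows for one-sided as well as two-sided limits.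
\<close>

lemma dual_volume_first_variation:
  fixes G Gt :: "real \<Rightarrow> real ^ 'n \<Rightarrow> real" and K :: "(real ^ 'n) set"
  assumes G_cont: "continuous_on ({0<..} \<times> sphere 0 1) (\<lambda>(t, u). G t u)"
    and Gt_deriv: "\<And>t u. 0 < t \<Longrightarrow> u \<in> sphere 0 1 \<Longrightarrow>
          ((\<lambda>s. G s u) has_real_derivative Gt t u) (at t)"
    and Gt_cont: "continuous_on ({0<..} \<times> sphere 0 1) (\<lambda>(t, u). Gt t u)"
    and K: "K \<in> star_bodies"
    and M: "\<forall>\<^sub>F \<epsilon> in at 0 within S. M \<epsilon> \<in> star_bodies"
    and lim: "\<And>u. u \<in> sphere 0 1 \<Longrightarrow>
          ((\<lambda>\<epsilon>. (radial_function (M \<epsilon>) u - radial_function K u) / \<epsilon>) \<longlongrightarrow> h u) (at 0 within S)"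
    and bound: "\<forall>\<^sub>F \<epsilon> in at 0 within S. \<forall>u\<in>sphere 0 1.
          \<bar>radial_function (M \<epsilon>) u - radial_function K u\<bar> \<le> C * \<bar>\<epsilon>\<bar>"
    and h: "continuous_on (sphere 0 1) h"
  shows "((\<lambda>\<epsilon>. (dual_volume G (M \<epsilon>) - dual_volume G K) / \<epsilon>) \<longlongrightarrow>
      (LINT u:sphere 0 1|hausdorff_measure (CARD('n) - 1). h u * Gt (radial_function K u) u))
      (at 0 within S)"
proof -
  let ?H = "hausdorff_measure (CARD('n) - 1) :: (real ^ 'n) measure"
  let ?k = "radial_function K"
  have cont: "continuous_on (sphere 0 1) (\<lambda>u. F (radial_function N u) u)"
    if "N \<in> star_bodies" "continuous_on ({0<..} \<times> sphere 0 1) (\<lambda>(t, u). F t u)"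
    for N and F :: "real \<Rightarrow> real ^ 'n \<Rightarrow> real"
  proof -
    have "continuous_on (sphere 0 1) (\<lambda>u. (\<lambda>(t, u). F t u) (radial_function N u, u))"
      using that by (intro continuous_on_compose2[OF that(2)] continuous_intros)
        (auto simp: star_bodies_def)
    then show ?thesis by simp
  qed
  obtain m R where mR: "0 < m" "m \<le> R" "\<And>u. u \<in> sphere 0 1 \<Longrightarrow> m \<le> ?k u"
      "\<And>u. u \<in> sphere 0 1 \<Longrightarrow> ?k u \<le> R"
    using star_body_radial_bounds[OF K] by metis
  let ?I = "{m / 2..2 * R}"
  have "compact ((\<lambda>(t, u). Gt t u) ` (?I \<times> sphere 0 1))"
    using mR by (intro compact_continuous_image compact_Times continuous_on_subset[OF Gt_cont]) auto
  then obtain B where B: "\<And>t u. t \<in> ?I \<Longrightarrow> u \<in> sphere 0 1 \<Longrightarrow> \<bar>Gt t u\<bar> \<le> B"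
    by (force dest!: compact_imp_bounded simp: bounded_iff)
  have lip: "\<bar>G s u - G t u\<bar> \<le> B * \<bar>s - t\<bar>" if "s \<in> ?I" "t \<in> ?I" "u \<in> sphere 0 1" for s t u
  proof -
    have "norm (G s u - G t u) \<le> B * norm (s - t)"
    proof (rule field_differentiable_bound[where S="?I" and f'="\<lambda>t. Gt t u"])
      show "((\<lambda>s. G s u) has_field_derivative Gt z u) (at z within ?I)" if "z \<in> ?I" for z
        using that mR \<open>u \<in> sphere 0 1\<close>
        by (intro has_field_derivative_at_within[OF Gt_deriv]) auto
    qed (use that B in auto)
    then show ?thesis by simp
  qed
  define P where "P \<epsilon> \<longleftrightarrow> M \<epsilon> \<in> star_bodies \<and>
      (\<forall>u\<in>sphere 0 1. \<bar>radial_function (M \<epsilon>) u - ?k u\<bar> \<le> C * \<bar>\<epsilon>\<bar>) \<and> C * \<bar>\<epsilon>\<bar> < m / 2" for \<epsilon>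
  have "((\<lambda>\<epsilon>. C * \<bar>\<epsilon>\<bar>) \<longlongrightarrow> C * \<bar>0\<bar>) (at 0 within S)" by (intro tendsto_intros)
  then have "\<forall>\<^sub>F \<epsilon> in at 0 within S. C * \<bar>\<epsilon>\<bar> < m / 2"
    using mR by (intro order_tendstoD(2)[where y="C * \<bar>0\<bar>"]) auto
  with M bound have ev: "\<forall>\<^sub>F \<epsilon> in at 0 within S. P \<epsilon>"
    unfolding P_def by eventually_elim auto
  define q where "q \<epsilon> u = (G (radial_function (M \<epsilon>) u) u - G (?k u) u) / \<epsilon>" for \<epsilon> u
  have q_lim: "((\<lambda>\<epsilon>. q \<epsilon> u) \<longlongrightarrow> h u * Gt (?k u) u) (at 0 within S)" if u: "u \<in> sphere 0 1" for u
  proof -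
    \<comment> \<open>With the radius of \<open>K\<close> as its value at \<open>0\<close>, the limit of quotients becomes a derivative, as the
      chain rule requires.\<close>
    define r where "r \<epsilon> = (if \<epsilon> = 0 then ?k u else radial_function (M \<epsilon>) u)" for \<epsilon>
    have "((\<lambda>\<epsilon>. (r \<epsilon> - r 0) / (\<epsilon> - 0)) \<longlongrightarrow> h u) (at 0 within S)"
      by (rule Lim_transform_eventually[OF lim[OF u]]) (auto simp: r_def eventually_at_filter)
    then have "(r has_real_derivative h u) (at 0 within S)"
      by (simp only: has_field_derivative_iff)
    moreover have "((\<lambda>s. G s u) has_real_derivative Gt (r 0) u) (at (r 0))"
      using mR(1) mR(3)[OF u] u by (intro Gt_deriv) (auto simp: r_def)
    ultimately have "((\<lambda>\<epsilon>. G (r \<epsilon>) u) has_real_derivative Gt (r 0) u * h u) (at 0 within S)"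
      by (rule DERIV_chain2[rotated])
    then have "((\<lambda>\<epsilon>. (G (r \<epsilon>) u - G (r 0) u) / (\<epsilon> - 0)) \<longlongrightarrow> Gt (r 0) u * h u) (at 0 within S)"
      by (simp only: has_field_derivative_iff)
    then have "((\<lambda>\<epsilon>. q \<epsilon> u) \<longlongrightarrow> Gt (r 0) u * h u) (at 0 within S)"
      by (rule Lim_transform_eventually) (auto simp: r_def q_def eventually_at_filter)
    then show ?thesis by (simp add: r_def mult.commute)
  qed
  have q_bound: "\<bar>q \<epsilon> u\<bar> \<le> B * C" if "P \<epsilon>" "\<epsilon> \<noteq> 0" "u \<in> sphere 0 1" for \<epsilon> u
  proof -
    have d: "\<bar>radial_function (M \<epsilon>) u - ?k u\<bar> \<le> C * \<bar>\<epsilon>\<bar>" "C * \<bar>\<epsilon>\<bar> < m / 2"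
      using that by (auto simp: P_def)
    have I: "radial_function (M \<epsilon>) u \<in> ?I" "?k u \<in> ?I"
      using d mR(1,2) mR(3,4)[OF that(3)] unfolding atLeastAtMost_iff by linarith+
    have "0 \<le> B" using B[OF I(2) that(3)] by linarith
    then have "B * \<bar>radial_function (M \<epsilon>) u - ?k u\<bar> \<le> B * (C * \<bar>\<epsilon>\<bar>)"
      using d by (intro mult_left_mono) auto
    with lip[OF I that(3)] have "\<bar>G (radial_function (M \<epsilon>) u) u - G (?k u) u\<bar> \<le> B * C * \<bar>\<epsilon>\<bar>"
      by simp
    then show ?thesis using that by (simp add: q_def pos_divide_le_eq)
  qed
  have int: "set_integrable ?H (sphere 0 1) (\<lambda>u. G (radial_function N u) u)" if "N \<in> star_bodies" for N
    using cont[OF that G_cont] by (rule integrable_on_sphere)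
  have q_int: "set_integrable ?H (sphere 0 1) (q \<epsilon>)" if "P \<epsilon>" for \<epsilon>
    unfolding q_def using int that K by (auto simp: P_def)
  have q_eq: "(LINT u:sphere 0 1|?H. q \<epsilon> u) = (dual_volume G (M \<epsilon>) - dual_volume G K) / \<epsilon>"
    if "P \<epsilon>" for \<epsilon>
    using int that K by (simp add: q_def dual_volume_def P_def set_integral_diff)
  have "((\<lambda>\<epsilon>. LINT u:sphere 0 1|?H. q \<epsilon> u) \<longlongrightarrow> (LINT u:sphere 0 1|?H. h u * Gt (?k u) u)) (at 0 within S)"
    unfolding tendsto_at_iff_sequentially
  proof (intro allI impI)
    fix X :: "nat \<Rightarrow> real" assume X: "\<forall>i. X i \<in> S - {0}" "X \<longlonglongrightarrow> 0"
    then have "filterlim X (at 0 within S) sequentially"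
      by (auto simp: filterlim_at)
    then have "\<forall>\<^sub>F i in sequentially. P (X i)"
      using ev by (rule eventually_compose_filterlim[rotated])
    then obtain N where N: "\<And>i. N \<le> i \<Longrightarrow> P (X i)" by (auto simp: eventually_sequentially)
    have "(\<lambda>i. LINT u:sphere 0 1|?H. q (X (i + N)) u) \<longlonglongrightarrow> (LINT u:sphere 0 1|?H. h u * Gt (?k u) u)"
      unfolding set_lebesgue_integral_def
    proof (rule integral_dominated_convergence[where w="\<lambda>u. indicator (sphere 0 1) u *\<^sub>R (B * C)"])
      have "set_integrable ?H (sphere 0 1) (\<lambda>u. h u * Gt (?k u) u)"
        using h cont[OF K Gt_cont] by (intro integrable_on_sphere continuous_on_mult)
      then show "(\<lambda>u. indicator (sphere 0 1) u *\<^sub>R (h u * Gt (?k u) u)) \<in> borel_measurable ?H"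
        unfolding set_integrable_def by (rule borel_measurable_integrable)
      show "(\<lambda>u. indicator (sphere 0 1) u *\<^sub>R q (X (i + N)) u) \<in> borel_measurable ?H" for i
        using q_int[OF N] unfolding set_integrable_def by (intro borel_measurable_integrable) auto
      show "integrable ?H (\<lambda>u. indicator (sphere 0 1) u *\<^sub>R (B * C))"
        using integrable_on_sphere[of "\<lambda>_. B * C"] by (simp add: set_integrable_def)
      show "AE u in ?H. (\<lambda>i. indicator (sphere 0 1) u *\<^sub>R q (X (i + N)) u)
          \<longlonglongrightarrow> indicator (sphere 0 1) u *\<^sub>R (h u * Gt (?k u) u)"
      proof (rule AE_I2)
        fix u :: "real ^ 'n"
        show "(\<lambda>i. indicator (sphere 0 1) u *\<^sub>R q (X (i + N)) u)
          \<longlonglongrightarrow> indicator (sphere 0 1) u *\<^sub>R (h u * Gt (?k u) u)"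
        proof (cases "u \<in> sphere 0 1")
          case True
          then have "(\<lambda>i. q (X i) u) \<longlonglongrightarrow> h u * Gt (?k u) u"
            using q_lim[OF True] X by (auto simp: tendsto_at_iff_sequentially comp_def)
          then show ?thesis by (intro tendsto_scaleR tendsto_const) (rule LIMSEQ_ignore_initial_segment)
        qed simp
      qed
      show "AE u in ?H. norm (indicator (sphere 0 1) u *\<^sub>R q (X (i + N)) u)
          \<le> indicator (sphere 0 1) u *\<^sub>R (B * C)" for i
        using q_bound[OF N] X by (intro AE_I2) (auto simp: indicator_def)
    qed
    then show "((\<lambda>\<epsilon>. LINT u:sphere 0 1|?H. q \<epsilon> u) \<circ> X) \<longlonglongrightarrow> (LINT u:sphere 0 1|?H. h u * Gt (?k u) u)"
      unfolding comp_def by (rule LIMSEQ_offset)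
  qed
  then show ?thesis
    by (rule Lim_transform_eventually) (use ev in \<open>eventually_elim, use q_eq in auto\<close>)
qed

section \<open>The scalar Orlicz equation\<close>

text \<open>
  In terms of the ratio \<open>x = \<rho>\<^sub>K(u) / r\<close>, the equation for the radius \<open>r\<close> of the Orlicz combination
  depends on the direction \<open>u\<close> only through the single number \<open>q = \<rho>\<^sub>L(u) / \<rho>\<^sub>K(u)\<close>.  The predicate
  collects what is needed of its root \<open>X \<epsilon> q\<close>: uniqueness, continuity in \<open>q\<close> (which makes the
  combination a star body), the derivative in \<open>\<epsilon>\<close> at \<open>0\<close>, where the root tends to \<open>1\<close>, and a
  Lipschitz bound at \<open>\<epsilon> = 0\<close> that is uniform for \<open>q\<close> in a compact interval.
\<close>

definition solution_branch ::
  "(real \<Rightarrow> real) \<Rightarrow> (real \<Rightarrow> real) \<Rightarrow> real \<Rightarrow> (real \<Rightarrow> real \<Rightarrow> real) \<Rightarrow> bool" where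
  "solution_branch \<phi>1 \<phi>2 d X \<longleftrightarrow>
     (\<forall>\<epsilon>>0. \<forall>q>0. 0 < X \<epsilon> q \<and> (\<forall>x>0. \<phi>1 x + \<epsilon> * \<phi>2 (q * x) = 1 \<longleftrightarrow> x = X \<epsilon> q)) \<and>
     (\<forall>\<epsilon>>0. continuous_on {0<..} (X \<epsilon>)) \<and>
     (\<forall>q>0. ((\<lambda>\<epsilon>. (X \<epsilon> q - 1) / \<epsilon>) \<longlongrightarrow> - \<phi>2 q / d) (at_right 0)) \<and>
     (\<forall>a>0. \<forall>b. \<exists>C. \<forall>\<^sub>F \<epsilon> in at_right 0. \<forall>q\<in>{a..b}. \<bar>X \<epsilon> q - 1\<bar> \<le> C * \<epsilon>)"

lemma solution_branchD:
  assumes "solution_branch \<phi>1 \<phi>2 d X"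
  shows "0 < \<epsilon> \<Longrightarrow> 0 < q \<Longrightarrow> 0 < X \<epsilon> q"
    and "0 < \<epsilon> \<Longrightarrow> 0 < q \<Longrightarrow> 0 < x \<Longrightarrow> \<phi>1 x + \<epsilon> * \<phi>2 (q * x) = 1 \<longleftrightarrow> x = X \<epsilon> q"
    and "0 < \<epsilon> \<Longrightarrow> continuous_on {0<..} (X \<epsilon>)"
    and "0 < q \<Longrightarrow> ((\<lambda>\<epsilon>. (X \<epsilon> q - 1) / \<epsilon>) \<longlongrightarrow> - \<phi>2 q / d) (at_right 0)"
    and "0 < a \<Longrightarrow> \<exists>C. \<forall>\<^sub>F \<epsilon> in at_right 0. \<forall>q\<in>{a..b}. \<bar>X \<epsilon> q - 1\<bar> \<le> C * \<epsilon>"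
  using assms unfolding solution_branch_def by simp_all

text \<open>
  The left-hand side increases strictly with \<open>x\<close> from \<open>0\<close> and exceeds \<open>1\<close> at \<open>x = 1\<close>, so there is one
  root, and it is less than \<open>1\<close>; this is why the left derivative of \<open>\<phi>1\<close> matters.  The root depends
  continuously on \<open>q\<close> because the sign of the left-hand side minus \<open>1\<close>, at a point on either side of
  the root, is stable under small changes of \<open>q\<close>.  Finally \<open>1 - \<phi>1 x = \<epsilon> * \<phi>2 (q * x)\<close> has order \<open>\<epsilon>\<close>,
  and the positive derivative \<open>d\<close> turns this into information on \<open>1 - x\<close>.
\<close>

lemma solution_branch_exists_I:
  assumes I: "\<phi>1 \<in> orlicz_I" "\<phi>2 \<in> orlicz_I"
    and deriv: "(\<phi>1 has_real_derivative d) (at_left 1)" and d: "0 < d"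
  shows "\<exists>X. solution_branch \<phi>1 \<phi>2 d X"
proof -
  have pos: "0 < \<phi>1 t" "0 < \<phi>2 t" if "0 < t" for t using I that by (auto simp: orlicz_I_def)
  have cont: "continuous_on {0<..} \<phi>1" "continuous_on {0<..} \<phi>2" and one: "\<phi>1 1 = 1"
    and lim0: "(\<phi>1 \<longlongrightarrow> 0) (at_right 0)" "(\<phi>2 \<longlongrightarrow> 0) (at_right 0)"
    using I by (auto simp: orlicz_I_def)
  have mono: "\<phi>1 s < \<phi>1 t" "\<phi>2 s < \<phi>2 t" if "0 < s" "s < t" for s t
    using I that by (auto simp: orlicz_I_def strict_mono_on_def)
  define H where "H \<epsilon> q x = \<phi>1 x + \<epsilon> * \<phi>2 (q * x)" for \<epsilon> q x
  have H_mono: "H \<epsilon> q x < H \<epsilon> q y" if "0 < \<epsilon>" "0 < q" "0 < x" "x < y" for \<epsilon> q x y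
    unfolding H_def using that by (intro add_strict_mono mult_strict_left_mono mono) auto
  have ex: "\<exists>x>0. H \<epsilon> q x = 1" if "0 < \<epsilon>" "0 < q" for \<epsilon> q
  proof -
    have "filterlim (\<lambda>x. q * x) (at_right 0) (at_right 0)"
      using that by (intro filterlim_times_pos[OF filterlim_ident]) auto
    then have "(H \<epsilon> q \<longlongrightarrow> 0 + \<epsilon> * 0) (at_right 0)"
      unfolding H_def by (intro tendsto_intros lim0 filterlim_compose[OF lim0(2)])
    then have "\<forall>\<^sub>F x in at_right 0. H \<epsilon> q x < 1" by (rule order_tendstoD) simp
    moreover have "\<forall>\<^sub>F x::real in at_right 0. x < 1" "\<forall>\<^sub>F x::real in at_right 0. 0 < x"
      by (auto simp: eventually_at_right_less intro: eventually_at_rightI[of 0 1])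
    ultimately have "\<forall>\<^sub>F x in at_right 0. H \<epsilon> q x < 1 \<and> x < 1 \<and> 0 < x" by eventually_elim auto
    then obtain x0 where x0: "H \<epsilon> q x0 < 1" "x0 < 1" "0 < x0"
      using eventually_happens[of _ "at_right (0::real)"] by (auto simp: trivial_limit_at_right_real)
    have "1 < H \<epsilon> q 1" using pos(2)[OF that(2)] that one by (simp add: H_def)
    moreover have "0 < q * x0" using x0 that by simp
    then have "0 < x" if "q * x0 \<le> x" for x using that by linarith
    then have "continuous_on {x0..1} (H \<epsilon> q)"
      unfolding H_def using x0 that
      by (intro continuous_intros continuous_on_subset[OF cont(1)] continuous_on_compose2[OF cont(2)])
        auto
    ultimately obtain x where "x0 \<le> x" "H \<epsilon> q x = 1"
      using IVT'[of "H \<epsilon> q" x0 1 1] x0 by auto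
    then show ?thesis using x0 by (intro exI[of _ x]) auto
  qed
  define X where "X \<epsilon> q = (SOME x. 0 < x \<and> H \<epsilon> q x = 1)" for \<epsilon> q
  have X: "0 < X \<epsilon> q" "H \<epsilon> q (X \<epsilon> q) = 1" if "0 < \<epsilon>" "0 < q" for \<epsilon> q
    using someI_ex[OF ex[OF that]] by (auto simp: X_def)
  have X_less: "X \<epsilon> q < x \<longleftrightarrow> 1 < H \<epsilon> q x" and X_greater: "x < X \<epsilon> q \<longleftrightarrow> H \<epsilon> q x < 1"
    if "0 < \<epsilon>" "0 < q" "0 < x" for \<epsilon> q x
    using H_mono[OF that(1,2), of x "X \<epsilon> q"] H_mono[OF that(1,2), of "X \<epsilon> q" x] X[OF that(1,2)] that
    by (metis less_asym linorder_neqE_linordered_idom)+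
  have "x = X \<epsilon> q \<longleftrightarrow> H \<epsilon> q x = 1" if "0 < \<epsilon>" "0 < q" "0 < x" for \<epsilon> q x
    using X_less[OF that] X_greater[OF that] by linarith
  then have sol: "\<forall>\<epsilon>>0. \<forall>q>0. 0 < X \<epsilon> q \<and> (\<forall>x>0. \<phi>1 x + \<epsilon> * \<phi>2 (q * x) = 1 \<longleftrightarrow> x = X \<epsilon> q)"
    using X by (simp add: H_def)
  have X_le: "X \<epsilon> q < 1" if "0 < \<epsilon>" "0 < q" for \<epsilon> q
    using X_less[OF that, of 1] one pos(2)[OF that(2)] that by (simp add: H_def)
  have contX: "continuous_on {0<..} (X \<epsilon>)" if \<epsilon>: "0 < \<epsilon>" for \<epsilon>
    unfolding continuous_on
  proof (intro ballI order_tendstoI)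
    fix q y :: real assume "q \<in> {0<..}"
    then have q: "0 < q" by simp
    have H_lim: "((\<lambda>q. H \<epsilon> q y) \<longlongrightarrow> H \<epsilon> q y) (at q within {0<..})" if "0 < y"
    proof -
      have "continuous_on {0<..} (\<lambda>q. H \<epsilon> q y)"
        unfolding H_def using that by (intro continuous_intros continuous_on_compose2[OF cont(2)]) auto
      then show ?thesis using q by (simp add: continuous_on)
    qed
    have ev: "\<forall>\<^sub>F q in at q within {0<..}. 0 < q" by (simp add: eventually_at_filter)
    show "\<forall>\<^sub>F q in at q within {0<..}. y < X \<epsilon> q" if y: "y < X \<epsilon> q"
    proof (cases "0 < y")
      case True
      then have "\<forall>\<^sub>F q in at q within {0<..}. H \<epsilon> q y < 1"
        using X_greater[OF \<epsilon> q True] y by (intro order_tendstoD(2)[OF H_lim]) auto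
      with ev show ?thesis by eventually_elim (use X_greater[OF \<epsilon> _ True] in auto)
    next
      case False
      from ev show ?thesis
        by eventually_elim (use X(1)[OF \<epsilon>] False in \<open>meson linorder_not_less order_le_less_trans\<close>)
    qed
    show "\<forall>\<^sub>F q in at q within {0<..}. X \<epsilon> q < y" if y: "X \<epsilon> q < y"
    proof -
      have y0: "0 < y" using X(1)[OF \<epsilon> q] y by linarith
      then have "\<forall>\<^sub>F q in at q within {0<..}. 1 < H \<epsilon> q y"
        using X_less[OF \<epsilon> q y0] y by (intro order_tendstoD(1)[OF H_lim]) auto
      with ev show ?thesis by eventually_elim (use X_less[OF \<epsilon> _ y0] in auto)
    qed
  qed
  have quot: "((\<lambda>x. (\<phi>1 x - 1) / (x - 1)) \<longlongrightarrow> d) (at_left 1)"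
    using deriv one by (simp add: has_field_derivative_iff)
  then have "\<forall>\<^sub>F x in at_left 1. d / 2 < (\<phi>1 x - 1) / (x - 1)"
    using d by (intro order_tendstoD) auto
  then obtain b where b: "b < 1" "\<And>x. b < x \<Longrightarrow> x < 1 \<Longrightarrow> d / 2 < (\<phi>1 x - 1) / (x - 1)"
    by (auto simp: eventually_at_left_field)
  \<comment> \<open>The maximum with \<open>1 / 2\<close> only ensures that \<open>\<phi>1\<close> is evaluated at a positive number.\<close>
  define c where "c = max b (1 / 2)"
  have c: "0 < c" "c < 1" using b by (auto simp: c_def)
  have slope: "1 - x \<le> 2 / d * (1 - \<phi>1 x)" if "c < x" "x < 1" for x
    using b(2)[of x] that d by (simp add: c_def field_simps)
  have rate: "\<exists>C. \<forall>\<^sub>F \<epsilon> in at_right 0. \<forall>q\<in>{a..b}. \<bar>X \<epsilon> q - 1\<bar> \<le> C * \<epsilon>" if a: "0 < a" for a b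
  proof (cases "a \<le> b")
    case True
    then have b: "0 < b" using a by simp
    have small: "1 - \<phi>1 (X \<epsilon> q) \<le> \<epsilon> * \<phi>2 b" if "0 < \<epsilon>" "q \<in> {a..b}" for \<epsilon> q
    proof -
      have q: "0 < q" "q \<le> b" using that a by auto
      have "q * X \<epsilon> q < b"
        using mult_strict_left_mono[OF X_le[OF that(1) q(1)] q(1)] q by linarith
      then have "\<epsilon> * \<phi>2 (q * X \<epsilon> q) \<le> \<epsilon> * \<phi>2 b"
        using mono(2)[of "q * X \<epsilon> q" b] X(1)[OF that(1) q(1)] q that by (intro mult_left_mono) auto
      then show ?thesis using X(2)[OF that(1) q(1)] by (simp add: H_def)
    qed
    \<comment> \<open>For \<open>\<epsilon>\<close> this small, monotonicity of \<open>\<phi>1\<close> forces the root into the interval from \<open>c\<close> to \<open>1\<close>,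
      where the chord estimate \<open>slope\<close> applies.\<close>
    have "((\<lambda>\<epsilon>. \<epsilon> * \<phi>2 b) \<longlongrightarrow> 0 * \<phi>2 b) (at_right 0)" by (intro tendsto_intros)
    moreover have "0 * \<phi>2 b < 1 - \<phi>1 c" using mono(1)[OF c] one by simp
    ultimately have "\<forall>\<^sub>F \<epsilon> in at_right 0. \<epsilon> * \<phi>2 b < 1 - \<phi>1 c" by (rule order_tendstoD)
    moreover have "\<forall>\<^sub>F \<epsilon>::real in at_right 0. 0 < \<epsilon>" by (rule eventually_at_right_less)
    ultimately have "\<forall>\<^sub>F \<epsilon> in at_right 0. \<forall>q\<in>{a..b}. \<bar>X \<epsilon> q - 1\<bar> \<le> (2 / d * \<phi>2 b) * \<epsilon>"
    proof eventually_elim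
      case (elim \<epsilon>)
      show ?case
      proof
        fix q assume q: "q \<in> {a..b}"
        then have q0: "0 < q" using a by auto
        have "\<phi>1 c < \<phi>1 (X \<epsilon> q)" using small[OF elim(2) q] elim by linarith
        then have "c < X \<epsilon> q"
          using mono(1)[of "X \<epsilon> q" c] X(1)[OF elim(2) q0] by (metis less_asym less_irrefl linorder_neqE_linordered_idom)
        then have "1 - X \<epsilon> q \<le> 2 / d * (1 - \<phi>1 (X \<epsilon> q))"
          using X_le[OF elim(2) q0] by (rule slope)
        also have "\<dots> \<le> 2 / d * (\<epsilon> * \<phi>2 b)"
          using small[OF elim(2) q] d by (intro mult_left_mono) auto
        finally show "\<bar>X \<epsilon> q - 1\<bar> \<le> (2 / d * \<phi>2 b) * \<epsilon>"
          using X_le[OF elim(2) q0] by (simp add: mult_ac)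
      qed
    qed
    then show ?thesis by blast
  qed simp
  have lim: "((\<lambda>\<epsilon>. (X \<epsilon> q - 1) / \<epsilon>) \<longlongrightarrow> - \<phi>2 q / d) (at_right 0)" if q: "0 < q" for q
  proof -
    have ev0: "\<forall>\<^sub>F \<epsilon>::real in at_right 0. 0 < \<epsilon>" by (rule eventually_at_right_less)
    obtain C where "\<forall>\<^sub>F \<epsilon> in at_right 0. \<forall>q\<in>{q..q}. \<bar>X \<epsilon> q - 1\<bar> \<le> C * \<epsilon>" using rate[OF q] by blast
    then have "\<forall>\<^sub>F \<epsilon> in at_right 0. norm (X \<epsilon> q - 1) \<le> C * \<epsilon>" by simp
    moreover have "((\<lambda>\<epsilon>. C * \<epsilon>) \<longlongrightarrow> 0) (at_right 0)"
      by (rule tendsto_mult_right_zero) (rule tendsto_ident_at)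
    ultimately have "((\<lambda>\<epsilon>. X \<epsilon> q - 1) \<longlongrightarrow> 0) (at_right 0)"
      by (rule Lim_null_comparison)
    then have X1: "((\<lambda>\<epsilon>. X \<epsilon> q) \<longlongrightarrow> 1) (at_right 0)" by (simp add: LIM_zero_iff)
    moreover have ev1: "\<forall>\<^sub>F \<epsilon> in at_right 0. X \<epsilon> q < 1" using ev0 by eventually_elim (rule X_le[OF _ q])
    ultimately have "filterlim (\<lambda>\<epsilon>. X \<epsilon> q) (at_left 1) (at_right 0)"
      by (auto simp: filterlim_at elim: eventually_mono)
    then have A: "((\<lambda>\<epsilon>. (\<phi>1 (X \<epsilon> q) - 1) / (X \<epsilon> q - 1)) \<longlongrightarrow> d) (at_right 0)"
      by (rule filterlim_compose[OF quot])
    have "isCont \<phi>2 q" using cont(2) q by (simp add: continuous_on_eq_continuous_at)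
    moreover have "((\<lambda>\<epsilon>. q * X \<epsilon> q) \<longlongrightarrow> q) (at_right 0)"
      using tendsto_mult_left[OF X1, of q] by simp
    ultimately have "((\<lambda>\<epsilon>. \<phi>2 (q * X \<epsilon> q)) \<longlongrightarrow> \<phi>2 q) (at_right 0)"
      by (rule isCont_tendsto_compose)
    with A have "((\<lambda>\<epsilon>. - \<phi>2 (q * X \<epsilon> q) / ((\<phi>1 (X \<epsilon> q) - 1) / (X \<epsilon> q - 1))) \<longlongrightarrow> - \<phi>2 q / d) (at_right 0)"
      using d by (intro tendsto_intros) auto
    moreover have "\<forall>\<^sub>F \<epsilon> in at_right 0.
        - \<phi>2 (q * X \<epsilon> q) / ((\<phi>1 (X \<epsilon> q) - 1) / (X \<epsilon> q - 1)) = (X \<epsilon> q - 1) / \<epsilon>"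
      using ev0 ev1
    proof eventually_elim
      case (elim \<epsilon>)
      have eq: "\<phi>1 (X \<epsilon> q) - 1 = - (\<epsilon> * \<phi>2 (q * X \<epsilon> q))"
        using X(2)[OF elim(1) q] by (simp add: H_def)
      moreover have "0 < \<phi>2 (q * X \<epsilon> q)" using X(1)[OF elim(1) q] q by (intro pos) simp
      ultimately show ?case using elim unfolding eq by (simp add: field_simps)
    qed
    ultimately show ?thesis by (rule Lim_transform_eventually)
  qed
  have "solution_branch \<phi>1 \<phi>2 d X"
    unfolding solution_branch_def using sol contX rate lim by simp
  then show ?thesis by blast
qed

lemma tendsto_one_if_quotient:
  fixes f :: "real \<Rightarrow> real"
  assumes "((\<lambda>\<epsilon>. (f \<epsilon> - 1) / \<epsilon>) \<longlongrightarrow> c) (at_right 0)"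
  shows "(f \<longlongrightarrow> 1) (at_right 0)"
proof -
  have "((\<lambda>\<epsilon>. 1 + (f \<epsilon> - 1) / \<epsilon> * \<epsilon>) \<longlongrightarrow> 1 + c * 0) (at_right 0)"
    by (intro tendsto_intros assms)
  moreover have "\<forall>\<^sub>F \<epsilon> in at_right 0. 1 + (f \<epsilon> - 1) / \<epsilon> * \<epsilon> = f \<epsilon>"
    by (intro eventually_mono[OF eventually_at_right_less]) simp
  ultimately have "(f \<longlongrightarrow> 1 + c * 0) (at_right 0)"
    by (rule Lim_transform_eventually)
  then show ?thesis by simp
qed

text \<open>
  The substitution \<open>t \<mapsto> 1 / t\<close> exchanges the two classes of Orlicz functions, and exchanges left and
  right at \<open>1\<close>.
\<close>

lemma orlicz_D_inverse:
  assumes "\<phi> \<in> orlicz_D"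
  shows "(\<lambda>t. \<phi> (inverse t)) \<in> orlicz_I"
proof -
  have D: "\<forall>t>0. 0 < \<phi> t" "continuous_on {0<..} \<phi>" "strict_antimono_on {0<..} \<phi>" "\<phi> 1 = 1"
    "filterlim \<phi> at_top (at_right 0)" "(\<phi> \<longlongrightarrow> 0) at_top"
    using assms by (auto simp: orlicz_D_def)
  have "continuous_on {0<..} (\<lambda>t. \<phi> (inverse t))"
    by (intro continuous_on_compose2[OF D(2)] continuous_intros) auto
  moreover have "strict_mono_on {0<..} (\<lambda>t. \<phi> (inverse t))"
  proof (rule strict_mono_onI)
    fix s t :: real assume "s \<in> {0<..}" "t \<in> {0<..}" "s < t"
    then show "\<phi> (inverse s) < \<phi> (inverse t)"
      by (intro monotone_onD[OF D(3)]) auto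
  qed
  moreover have "((\<lambda>t. \<phi> (inverse t)) \<longlongrightarrow> 0) (at_right 0)"
    by (rule filterlim_compose[OF D(6) filterlim_inverse_at_top_right])
  moreover have "filterlim (\<lambda>t. \<phi> (inverse t)) at_top at_top"
    by (rule filterlim_compose[OF D(5) filterlim_inverse_at_right_top])
  ultimately show ?thesis using D by (simp add: orlicz_I_def)
qed

text \<open>
  If \<open>Y\<close> is the branch for the increasing functions \<open>\<phi>\<^sub>i (1 / t)\<close>, then \<open>1 / Y \<epsilon> (1 / q)\<close> is the branch
  for \<open>\<phi>1\<close> and \<open>\<phi>2\<close>.  The derivative at \<open>1\<close> changes sign under the substitution, and so does that of the
  root, so the formula for the derivative of the branch is the same in both cases.
\<close>

lemma solution_branch_exists_D:
  assumes D: "\<phi>1 \<in> orlicz_D" "\<phi>2 \<in> orlicz_D"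
    and deriv: "(\<phi>1 has_real_derivative d) (at_right 1)" and d: "d < 0"
  shows "\<exists>X. solution_branch \<phi>1 \<phi>2 d X"
proof -
  let ?\<psi>1 = "\<lambda>t. \<phi>1 (inverse t)" and ?\<psi>2 = "\<lambda>t. \<phi>2 (inverse t)"
  \<comment> \<open>Restricting to positive arguments makes the image under \<open>inverse\<close> a subset of the right-hand side
    of \<open>1\<close>.\<close>
  have "at_left (1::real) = at 1 within {0<..<1}"
    by (rule at_within_nhd[of _ "{0<..}"]) auto
  moreover have "(inverse has_real_derivative - 1) (at (1::real) within {0<..<1})"
    using DERIV_inverse[of "1::real" "{0<..<1}"] by simp
  moreover have "inverse ` {0<..<1} \<subseteq> {1::real<..}"
    by (auto intro: one_less_inverse)
  then have "(\<phi>1 has_real_derivative d) (at (inverse 1) within inverse ` {0<..<1})"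
    using has_field_derivative_subset[OF deriv] by simp
  ultimately have "(?\<psi>1 has_real_derivative d * - 1) (at_left 1)"
    using DERIV_image_chain[of \<phi>1 d inverse 1 "{0<..<1}" "- 1"] by (simp add: comp_def)
  then have deriv': "(?\<psi>1 has_real_derivative - d) (at_left 1)" by simp
  obtain Y where "solution_branch ?\<psi>1 ?\<psi>2 (- d) Y"
    using solution_branch_exists_I[OF orlicz_D_inverse[OF D(1)] orlicz_D_inverse[OF D(2)] deriv'] d
    by auto
  note Y = solution_branchD(1,2)[OF this] and contY = solution_branchD(3)[OF this]
    and limY = solution_branchD(4)[OF this] and rateY = solution_branchD(5)[OF this]
  define X where "X \<epsilon> q = inverse (Y \<epsilon> (inverse q))" for \<epsilon> q
  have ev0: "\<forall>\<^sub>F \<epsilon>::real in at_right 0. 0 < \<epsilon>" by (rule eventually_at_right_less)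
  have X_diff: "X \<epsilon> q - 1 = - (Y \<epsilon> (inverse q) - 1) / Y \<epsilon> (inverse q)" if "0 < \<epsilon>" "0 < q" for \<epsilon> q
    using Y(1)[OF that(1), of "inverse q"] that by (simp add: X_def field_simps)
  have "\<phi>1 x + \<epsilon> * \<phi>2 (q * x) = 1 \<longleftrightarrow> x = X \<epsilon> q" if "0 < \<epsilon>" "0 < q" "0 < x" for \<epsilon> q x
    using Y(2)[OF that(1), of "inverse q" "inverse x"] that
    by (auto simp: X_def inverse_eq_iff_eq[of x, symmetric]) 
  moreover have "continuous_on {0<..} (X \<epsilon>)" if "0 < \<epsilon>" for \<epsilon>
    unfolding X_def using Y(1)[OF that]
    by (intro continuous_intros continuous_on_compose2[OF contY[OF that]]) (auto simp: less_imp_neq[symmetric])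
  moreover have "((\<lambda>\<epsilon>. (X \<epsilon> q - 1) / \<epsilon>) \<longlongrightarrow> - \<phi>2 q / d) (at_right 0)" if q: "0 < q" for q
  proof -
    have L: "((\<lambda>\<epsilon>. (Y \<epsilon> (inverse q) - 1) / \<epsilon>) \<longlongrightarrow> \<phi>2 q / d) (at_right 0)"
      using limY[of "inverse q"] q by simp
    have "((\<lambda>\<epsilon>. - ((Y \<epsilon> (inverse q) - 1) / \<epsilon>) / Y \<epsilon> (inverse q)) \<longlongrightarrow> - (\<phi>2 q / d) / 1) (at_right 0)"
      by (intro tendsto_intros L tendsto_one_if_quotient[OF L]) auto
    moreover have "\<forall>\<^sub>F \<epsilon> in at_right 0.
        - ((Y \<epsilon> (inverse q) - 1) / \<epsilon>) / Y \<epsilon> (inverse q) = (X \<epsilon> q - 1) / \<epsilon>"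
      using ev0
    proof eventually_elim
      case (elim \<epsilon>)
      then show ?case
        unfolding X_diff[OF elim q] by (simp add: divide_simps)
    qed
    ultimately have "((\<lambda>\<epsilon>. (X \<epsilon> q - 1) / \<epsilon>) \<longlongrightarrow> - (\<phi>2 q / d) / 1) (at_right 0)"
      by (rule Lim_transform_eventually)
    then show ?thesis by simp
  qed
  moreover have "\<exists>C. \<forall>\<^sub>F \<epsilon> in at_right 0. \<forall>q\<in>{a..b}. \<bar>X \<epsilon> q - 1\<bar> \<le> C * \<epsilon>" if a: "0 < a" for a b
  proof (cases "a \<le> b")
    case True
    then obtain C where C: "\<forall>\<^sub>F \<epsilon> in at_right 0. \<forall>q\<in>{inverse b..inverse a}. \<bar>Y \<epsilon> q - 1\<bar> \<le> C * \<epsilon>"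
      using rateY[of "inverse b"] a by auto
    have "((\<lambda>\<epsilon>. C * \<epsilon>) \<longlongrightarrow> C * 0) (at_right 0)" by (intro tendsto_intros)
    \<comment> \<open>This keeps \<open>Y\<close> above \<open>1 / 2\<close>, so that passing to \<open>1 / Y\<close> at most doubles the constant.\<close>
    then have "\<forall>\<^sub>F \<epsilon> in at_right 0. C * \<epsilon> < 1 / 2" by (rule order_tendstoD) simp
    with C ev0 have "\<forall>\<^sub>F \<epsilon> in at_right 0. \<forall>q\<in>{a..b}. \<bar>X \<epsilon> q - 1\<bar> \<le> 2 * C * \<epsilon>"
    proof eventually_elim
      case (elim \<epsilon>)
      show ?case
      proof
        fix q assume q: "q \<in> {a..b}"
        then have q0: "0 < q" and "inverse q \<in> {inverse b..inverse a}" using a by auto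
        then have *: "\<bar>Y \<epsilon> (inverse q) - 1\<bar> \<le> C * \<epsilon>" using elim by blast
        then have Y2: "1 / 2 \<le> Y \<epsilon> (inverse q)" using elim by linarith
        have "\<bar>X \<epsilon> q - 1\<bar> = \<bar>Y \<epsilon> (inverse q) - 1\<bar> / Y \<epsilon> (inverse q)"
          using X_diff[OF elim(2) q0] Y2 by simp
        also have "\<dots> \<le> \<bar>Y \<epsilon> (inverse q) - 1\<bar> / (1 / 2)"
          using Y2 by (intro divide_left_mono) auto
        also have "\<dots> \<le> 2 * C * \<epsilon>" using * by simp
        finally show "\<bar>X \<epsilon> q - 1\<bar> \<le> 2 * C * \<epsilon>" .
      qed
    qed
    then show ?thesis by blast
  qed simp
  moreover have "0 < X \<epsilon> q" if "0 < \<epsilon>" "0 < q" for \<epsilon> q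
    using Y(1)[OF that(1)] that by (simp add: X_def)
  ultimately have "solution_branch \<phi>1 \<phi>2 d X"
    unfolding solution_branch_def by simp
  then show ?thesis by blast
qed

section \<open>Orlicz combinations of star bodies\<close>

lemma orlicz_equation_iff_branch:
  assumes X: "solution_branch \<phi>1 \<phi>2 d X" and \<epsilon>: "0 < \<epsilon>"
    and pos: "0 < radial_function K u" "0 < radial_function L u" and r: "0 < r"
  shows "orlicz_equation \<phi>1 \<phi>2 \<epsilon> K L u r \<longleftrightarrow>
     r = radial_function K u / X \<epsilon> (radial_function L u / radial_function K u)"
proof -
  define k q where "k = radial_function K u" and "q = radial_function L u / k"
  have kq: "0 < k" "0 < q" using pos by (auto simp: k_def q_def)
  have "orlicz_equation \<phi>1 \<phi>2 \<epsilon> K L u r \<longleftrightarrow> \<phi>1 (k / r) + \<epsilon> * \<phi>2 (q * (k / r)) = 1"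
    using kq unfolding orlicz_equation_def by (simp add: q_def k_def)
  also have "\<dots> \<longleftrightarrow> k / r = X \<epsilon> q"
    using solution_branchD(2)[OF X \<epsilon> kq(2), of "k / r"] kq r by simp
  also have "\<dots> \<longleftrightarrow> r = k / X \<epsilon> q"
    using solution_branchD(1)[OF X \<epsilon> kq(2)] kq r by (auto simp: field_simps)
  finally show ?thesis by (simp add: k_def q_def)
qed

text \<open>
  Since the radius of the combination is \<open>\<rho>\<^sub>K(u) / X \<epsilon> (q u)\<close>, all hypotheses of the variation formula
  are read off the branch: \<open>X\<close> has derivative \<open>- \<phi>2 q / d\<close> at \<open>\<epsilon> = 0\<close>, so the radius
  has derivative \<open>\<rho>\<^sub>K * \<phi>2 q / d\<close>.  The ratios \<open>q u\<close> fill a compact interval as \<open>u\<close> runs over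
  the sphere, which is what the uniform bound needs.  The argument is the same for increasing and
  decreasing functions.
\<close>

lemma dual_volume_orlicz_variation:
  fixes G Gt :: "real \<Rightarrow> real ^ 'n \<Rightarrow> real" and K L :: "(real ^ 'n) set"
  assumes G_cont: "continuous_on ({0<..} \<times> sphere 0 1) (\<lambda>(t, u). G t u)"
    and Gt_deriv: "\<And>t u. 0 < t \<Longrightarrow> u \<in> sphere 0 1 \<Longrightarrow>
          ((\<lambda>s. G s u) has_real_derivative Gt t u) (at t)"
    and Gt_cont: "continuous_on ({0<..} \<times> sphere 0 1) (\<lambda>(t, u). Gt t u)"
    and K: "K \<in> star_bodies" and L: "L \<in> star_bodies"
    and X: "solution_branch \<phi>1 \<phi>2 d X"
    and \<phi>2: "continuous_on {0<..} \<phi>2" and d: "d \<noteq> 0"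
  shows "(\<forall>\<epsilon>>0. (\<forall>u\<in>sphere 0 1. \<exists>!r. 0 < r \<and> orlicz_equation \<phi>1 \<phi>2 \<epsilon> K L u r) \<and>
                 (\<exists>M. is_orlicz_combination \<phi>1 \<phi>2 \<epsilon> K L M)) \<and>
        (\<forall>K\<epsilon>. (\<forall>\<epsilon>>0. is_orlicz_combination \<phi>1 \<phi>2 \<epsilon> K L (K\<epsilon> \<epsilon>)) \<longrightarrow>
          ((\<lambda>\<epsilon>. (dual_volume G (K\<epsilon> \<epsilon>) - dual_volume G K) / \<epsilon>) \<longlongrightarrow>
             1 / d * (LINT u:sphere 0 1|hausdorff_measure (CARD('n) - 1).
               \<phi>2 (radial_function L u / radial_function K u) * radial_function K u
                 * Gt (radial_function K u) u)) (at_right 0))"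
proof -
  define k l where "k = radial_function K" and "l = radial_function L"
  define q where "q u = l u / k u" for u
  have pos: "0 < k u" "0 < l u" if "u \<in> sphere 0 1" for u
    using K L that by (auto simp: star_bodies_def k_def l_def)
  have cont: "continuous_on (sphere 0 1) k" "continuous_on (sphere 0 1) l"
    using K L by (auto simp: star_bodies_def k_def l_def)
  have q_pos: "0 < q u" if "u \<in> sphere 0 1" for u using pos[OF that] by (simp add: q_def)
  have q_cont: "continuous_on (sphere 0 1) q"
    unfolding q_def by (intro continuous_intros cont) (use pos in force)
  have X_pos: "0 < X \<epsilon> p" and X_cont: "continuous_on {0<..} (X \<epsilon>)" if "0 < \<epsilon>" "0 < p" for \<epsilon> p
    using solution_branchD(1,3)[OF X] that by auto
  have root: "0 < r \<and> orlicz_equation \<phi>1 \<phi>2 \<epsilon> K L u r \<longleftrightarrow> r = k u / X \<epsilon> (q u)"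
    if "0 < \<epsilon>" "u \<in> sphere 0 1" for \<epsilon> u r
    using orlicz_equation_iff_branch[OF X that(1), of K u L r] pos[OF that(2)]
      X_pos[OF that(1) q_pos[OF that(2)]]
    by (auto simp: k_def l_def q_def)
  have "\<exists>M. is_orlicz_combination \<phi>1 \<phi>2 \<epsilon> K L M" if \<epsilon>: "0 < \<epsilon>" for \<epsilon>
  proof -
    have "continuous_on (sphere 0 1) (\<lambda>u. k u / X \<epsilon> (q u))"
      using q_pos X_pos[OF \<epsilon>]
      by (intro continuous_intros cont continuous_on_compose2[OF X_cont[OF \<epsilon> zero_less_one] q_cont])
        (auto simp: less_imp_neq[symmetric])
    moreover have "0 < k u / X \<epsilon> (q u)" if "u \<in> sphere 0 1" for u
      using pos(1)[OF that] X_pos[OF \<epsilon> q_pos[OF that]] by simp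
    ultimately obtain M where "M \<in> star_bodies" "\<forall>u\<in>sphere 0 1. radial_function M u = k u / X \<epsilon> (q u)"
      using exists_star_body_with_radial_function by blast
    then have "is_orlicz_combination \<phi>1 \<phi>2 \<epsilon> K L M"
      using root[OF \<epsilon>] unfolding is_orlicz_combination_def by blast
    then show ?thesis ..
  qed
  moreover have "\<exists>!r. 0 < r \<and> orlicz_equation \<phi>1 \<phi>2 \<epsilon> K L u r"
    if "0 < \<epsilon>" "u \<in> sphere 0 1" for \<epsilon> u
    using root[OF that] by simp
  moreover have "((\<lambda>\<epsilon>. (dual_volume G (M \<epsilon>) - dual_volume G K) / \<epsilon>) \<longlongrightarrow>
             1 / d * (LINT u:sphere 0 1|hausdorff_measure (CARD('n) - 1).
               \<phi>2 (l u / k u) * k u * Gt (k u) u)) (at_right 0)"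
    if M: "\<forall>\<epsilon>>0. is_orlicz_combination \<phi>1 \<phi>2 \<epsilon> K L (M \<epsilon>)" for M
  proof -
    have ev0: "\<forall>\<^sub>F \<epsilon>::real in at_right 0. 0 < \<epsilon>" by (rule eventually_at_right_less)
    have star: "M \<epsilon> \<in> star_bodies" if "0 < \<epsilon>" for \<epsilon>
      using M that by (simp add: is_orlicz_combination_def)
    have rad: "radial_function (M \<epsilon>) u = k u / X \<epsilon> (q u)" if "0 < \<epsilon>" "u \<in> sphere 0 1" for \<epsilon> u
      using M that root[OF that, of "radial_function (M \<epsilon>) u"] star[OF that(1)]
      by (auto simp: is_orlicz_combination_def star_bodies_def)
    have diff: "radial_function (M \<epsilon>) u - k u = - k u * (X \<epsilon> (q u) - 1) / X \<epsilon> (q u)"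
      if "0 < \<epsilon>" "u \<in> sphere 0 1" for \<epsilon> u
      using rad[OF that] X_pos[OF that(1) q_pos[OF that(2)]] by (simp add: field_simps)
    obtain m R where R: "\<And>u. u \<in> sphere 0 1 \<Longrightarrow> k u \<le> R" "0 < R"
      using star_body_radial_bounds[OF K] unfolding k_def by (metis less_le_trans)
    have ne: "sphere (0::real ^ 'n) 1 \<noteq> {}" by simp
    obtain v w where vw: "v \<in> sphere 0 1" "w \<in> sphere 0 1" "\<forall>u\<in>sphere 0 1. q v \<le> q u \<and> q u \<le> q w"
      using continuous_attains_inf[OF compact_sphere ne q_cont] continuous_attains_sup[OF compact_sphere ne q_cont]
      by metis
    obtain C where C: "\<forall>\<^sub>F \<epsilon> in at_right 0. \<forall>p\<in>{q v..q w}. \<bar>X \<epsilon> p - 1\<bar> \<le> C * \<epsilon>"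
      using solution_branchD(5)[OF X q_pos[OF vw(1)]] by blast
    have "((\<lambda>\<epsilon>. C * \<epsilon>) \<longlongrightarrow> C * 0) (at_right 0)" by (intro tendsto_intros)
    \<comment> \<open>Division by \<open>X\<close> is harmless once \<open>X\<close> is at least \<open>1 / 2\<close>.\<close>
    then have small: "\<forall>\<^sub>F \<epsilon> in at_right 0. C * \<epsilon> < 1 / 2" by (rule order_tendstoD) simp
    have "((\<lambda>\<epsilon>. (dual_volume G (M \<epsilon>) - dual_volume G K) / \<epsilon>) \<longlongrightarrow>
        (LINT u:sphere 0 1|hausdorff_measure (CARD('n) - 1).
          (1 / d * (\<phi>2 (q u) * k u)) * Gt (radial_function K u) u)) (at_right 0)"
    proof (rule dual_volume_first_variation[OF G_cont Gt_deriv Gt_cont K, where C="2 * R * C"])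
      show "\<forall>\<^sub>F \<epsilon> in at_right 0. M \<epsilon> \<in> star_bodies"
        using ev0 by eventually_elim (rule star)
      show "\<forall>\<^sub>F \<epsilon> in at_right 0. \<forall>u\<in>sphere 0 1.
          \<bar>radial_function (M \<epsilon>) u - radial_function K u\<bar> \<le> 2 * R * C * \<bar>\<epsilon>\<bar>"
        using C small ev0
      proof eventually_elim
        case (elim \<epsilon>)
        show ?case
        proof
          fix u :: "real ^ 'n" assume u: "u \<in> sphere 0 1"
          have X1: "\<bar>X \<epsilon> (q u) - 1\<bar> \<le> C * \<epsilon>" using elim(1) vw(3) u by simp
          then have X2: "1 / 2 \<le> X \<epsilon> (q u)" using elim(2) by linarith
          have "\<bar>radial_function (M \<epsilon>) u - k u\<bar> = k u * \<bar>X \<epsilon> (q u) - 1\<bar> / X \<epsilon> (q u)"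
            using diff[OF elim(3) u] X2 pos(1)[OF u] by (simp add: abs_mult)
          also have "\<dots> \<le> R * (C * \<epsilon>) / (1 / 2)"
            using X1 X2 R(1)[OF u] pos(1)[OF u] R(2) by (intro frac_le mult_mono) auto
          finally show "\<bar>radial_function (M \<epsilon>) u - radial_function K u\<bar> \<le> 2 * R * C * \<bar>\<epsilon>\<bar>"
            using elim(3) by (simp add: k_def mult_ac)
        qed
      qed
      show "continuous_on (sphere 0 1) (\<lambda>u. 1 / d * (\<phi>2 (q u) * k u))"
        using q_pos by (intro continuous_intros cont continuous_on_compose2[OF \<phi>2 q_cont]) auto
      show "((\<lambda>\<epsilon>. (radial_function (M \<epsilon>) u - radial_function K u) / \<epsilon>) \<longlongrightarrow> 1 / d * (\<phi>2 (q u) * k u))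
          (at_right 0)" if u: "u \<in> sphere 0 1" for u
      proof -
        have L: "((\<lambda>\<epsilon>. (X \<epsilon> (q u) - 1) / \<epsilon>) \<longlongrightarrow> - \<phi>2 (q u) / d) (at_right 0)"
          using solution_branchD(4)[OF X q_pos[OF u]] .
        have "((\<lambda>\<epsilon>. - k u * ((X \<epsilon> (q u) - 1) / \<epsilon>) / X \<epsilon> (q u)) \<longlongrightarrow>
            - k u * (- \<phi>2 (q u) / d) / 1) (at_right 0)"
          by (intro tendsto_intros L tendsto_one_if_quotient[OF L]) auto
        moreover have "\<forall>\<^sub>F \<epsilon> in at_right 0. - k u * ((X \<epsilon> (q u) - 1) / \<epsilon>) / X \<epsilon> (q u)
            = (radial_function (M \<epsilon>) u - radial_function K u) / \<epsilon>"
          using ev0 by eventually_elim (use diff[OF _ u] in \<open>simp add: k_def mult_ac\<close>)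
        ultimately have "((\<lambda>\<epsilon>. (radial_function (M \<epsilon>) u - radial_function K u) / \<epsilon>) \<longlongrightarrow>
            - k u * (- \<phi>2 (q u) / d) / 1) (at_right 0)"
          by (rule Lim_transform_eventually)
        then show ?thesis by (simp add: mult.commute)
      qed
    qed
    then show ?thesis by (simp add: q_def k_def mult.assoc)
  qed
  ultimately show ?thesis unfolding k_def l_def by blast
qed

section \<open>Perturbation of the radial function through \<open>\<phi>\<close>\<close>

lemma orlicz_J_inj_on:
  assumes "\<phi> \<in> orlicz_J a"
  shows "inj_on \<phi> {0<..}"
proof (rule linorder_inj_onI)
  fix x y :: real assume "x < y" "x \<in> {0<..}" "y \<in> {0<..}"
  moreover have "strict_mono_on {0<..} \<phi> \<or> strict_antimono_on {0<..} \<phi>"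
    using assms by (simp add: orlicz_J_def)
  ultimately show "\<phi> x \<noteq> \<phi> y"
    using monotone_onD[of "{0<..}" "(<)" "(<)" \<phi> x y] monotone_onD[of "{0<..}" "(<)" "(>)" \<phi> x y]
    by auto
qed auto

text \<open>
  The values of \<open>\<phi>\<close> on an interval stay away from its values at the ends of a larger interval.
  Hence a small perturbation of \<open>\<phi> (\<rho>\<^sub>K(u))\<close> is still a value of \<open>\<phi>\<close>, taken on a fixed compact interval
  of positive numbers.
\<close>

lemma orlicz_J_image_interval:
  assumes \<phi>: "\<phi> \<in> orlicz_J a" and t: "0 < s" "s < m" "m \<le> R" "R < T"
  obtains \<eta> where "0 < \<eta>" "\<And>t c. t \<in> {m..R} \<Longrightarrow> \<bar>c\<bar> \<le> \<eta> \<Longrightarrow> \<phi> t + c \<in> \<phi> ` {s..T}"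
proof -
  have cont: "continuous_on {s..T} \<phi>"
    using \<phi> t by (auto simp: orlicz_J_def intro: continuous_on_subset)
  consider "strict_mono_on {0<..} \<phi>" | "strict_antimono_on {0<..} \<phi>"
    using \<phi> by (auto simp: orlicz_J_def)
  then show ?thesis
  proof cases
    case 1
    have lt: "\<phi> x < \<phi> y" if "0 < x" "x < y" for x y
      using 1 that by (auto simp: strict_mono_on_def)
    let ?\<eta> = "min (\<phi> m - \<phi> s) (\<phi> T - \<phi> R)"
    show ?thesis
    proof (rule that[of ?\<eta>])
      show "0 < ?\<eta>" using lt[of s m] lt[of R T] t by simp
      fix x c assume "x \<in> {m..R}" and c: "\<bar>c\<bar> \<le> ?\<eta>"
      then have "\<phi> m \<le> \<phi> x" "\<phi> x \<le> \<phi> R"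
        using lt[of m x] lt[of x R] t by (auto simp: le_less)
      with c have "\<phi> s \<le> \<phi> x + c" "\<phi> x + c \<le> \<phi> T" by linarith+
      then show "\<phi> x + c \<in> \<phi> ` {s..T}"
        using IVT'[of \<phi> s "\<phi> x + c" T] cont t by force
    qed
  next
    case 2
    have lt: "\<phi> y < \<phi> x" if "0 < x" "x < y" for x y
      using 2 that by (auto simp: monotone_on_def)
    let ?\<eta> = "min (\<phi> s - \<phi> m) (\<phi> R - \<phi> T)"
    show ?thesis
    proof (rule that[of ?\<eta>])
      show "0 < ?\<eta>" using lt[of s m] lt[of R T] t by simp
      fix x c assume "x \<in> {m..R}" and c: "\<bar>c\<bar> \<le> ?\<eta>"
      then have "\<phi> R \<le> \<phi> x" "\<phi> x \<le> \<phi> m"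
        using lt[of m x] lt[of x R] t by (auto simp: le_less)
      with c have "\<phi> T \<le> \<phi> x + c" "\<phi> x + c \<le> \<phi> s" by linarith+
      then show "\<phi> x + c \<in> \<phi> ` {s..T}"
        using IVT2'[of \<phi> T "\<phi> x + c" s] cont t by force
    qed
  qed
qed

text \<open>
  For small \<open>\<epsilon>\<close> all radii lie in the interval from \<open>m / 2\<close> to \<open>2 * R\<close>, where \<open>m\<close> and \<open>R\<close> bound the radii of
  \<open>K\<close>.  There \<open>\<phi>\<close> is a homeomorphism onto its image, whence the new radial function is continuous, and
  \<open>\<bar>\<phi>'\<bar>\<close> has a positive minimum \<open>\<mu>\<close>, so that \<open>\<phi>\<close> expands distances by at least \<open>\<mu>\<close>.  This makes the radii
  Lipschitz in \<open>\<epsilon>\<close>, and the derivative of the inverse function gives their derivative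
  \<open>g u / \<phi>' (\<rho>\<^sub>K(u))\<close> at \<open>\<epsilon> = 0\<close>.
\<close>

lemma dual_volume_phi_variation:
  fixes G Gt :: "real \<Rightarrow> real ^ 'n \<Rightarrow> real" and K :: "(real ^ 'n) set"
  assumes G_cont: "continuous_on ({0<..} \<times> sphere 0 1) (\<lambda>(t, u). G t u)"
    and Gt_deriv: "\<And>t u. 0 < t \<Longrightarrow> u \<in> sphere 0 1 \<Longrightarrow>
          ((\<lambda>s. G s u) has_real_derivative Gt t u) (at t)"
    and Gt_cont: "continuous_on ({0<..} \<times> sphere 0 1) (\<lambda>(t, u). Gt t u)"
    and K: "K \<in> star_bodies"
    and \<phi>: "\<phi> \<in> orlicz_J a"
    and deriv: "\<forall>t>0. (\<phi> has_real_derivative \<phi>' t) (at t)"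
    and \<phi>'_cont: "continuous_on {0<..} \<phi>'" and \<phi>'_nz: "\<forall>t>0. \<phi>' t \<noteq> 0"
    and g: "continuous_on (sphere 0 1) g"
  shows "(\<forall>\<^sub>F \<epsilon> in nhds 0.
           (\<forall>u\<in>sphere 0 1. a < ereal (\<phi> (radial_function K u) + \<epsilon> * g u)) \<and>
           (\<exists>M. is_phi_perturbation \<phi> g \<epsilon> K M)) \<and>
        (\<forall>K\<epsilon>. (\<forall>\<^sub>F \<epsilon> in nhds 0. is_phi_perturbation \<phi> g \<epsilon> K (K\<epsilon> \<epsilon>)) \<longrightarrow>
          ((\<lambda>\<epsilon>. (dual_volume G (K\<epsilon> \<epsilon>) - dual_volume G K) / \<epsilon>) \<longlongrightarrow>
             (LINT u:sphere 0 1|hausdorff_measure (CARD('n) - 1).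
               g u * Gt (radial_function K u) u / \<phi>' (radial_function K u))) (at 0))"
proof -
  define k where "k = radial_function K"
  have k: "continuous_on (sphere 0 1) k" "\<And>u. u \<in> sphere 0 1 \<Longrightarrow> 0 < k u"
    using K by (auto simp: star_bodies_def k_def)
  obtain m R where mR: "0 < m" "m \<le> R" "\<And>u. u \<in> sphere 0 1 \<Longrightarrow> k u \<in> {m..R}"
    using star_body_radial_bounds[OF K] unfolding k_def by (metis atLeastAtMost_iff)
  let ?I = "{m / 2..2 * R}"
  let ?\<psi> = "the_inv_into {0<..} \<phi>"
  have I_pos: "0 < t" if "t \<in> ?I" for t using that mR by auto
  have inj: "inj_on \<phi> {0<..}" using \<phi> by (rule orlicz_J_inj_on)
  have \<psi>: "?\<psi> (\<phi> t) = t" if "0 < t" for t using the_inv_into_f_f[OF inj] that by simp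
  have \<phi>_cont: "continuous_on {0<..} \<phi>" using \<phi> by (simp add: orlicz_J_def)
  have \<psi>_cont: "continuous_on (\<phi> ` ?I) ?\<psi>"
    using \<psi> I_pos by (intro continuous_on_inv continuous_on_subset[OF \<phi>_cont]) auto
  obtain \<eta> where \<eta>: "0 < \<eta>" "\<And>t c. t \<in> {m..R} \<Longrightarrow> \<bar>c\<bar> \<le> \<eta> \<Longrightarrow> \<phi> t + c \<in> \<phi> ` ?I"
    using orlicz_J_image_interval[OF \<phi>, of "m / 2" m R "2 * R"] mR by auto
  obtain B where "0 < B" and "\<forall>u\<in>sphere 0 1. \<bar>g u\<bar> \<le> B"
    using compact_imp_bounded[OF compact_continuous_image[OF g compact_sphere]]
    by (auto simp: bounded_pos)
  then have B: "\<bar>g u\<bar> \<le> B" if "u \<in> sphere 0 1" for u using that by blast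
  define r where "r \<epsilon> u = ?\<psi> (\<phi> (k u) + \<epsilon> * g u)" for \<epsilon> u
  define small where "small \<epsilon> \<longleftrightarrow> \<bar>\<epsilon>\<bar> * B < \<eta>" for \<epsilon>
  have "((\<lambda>\<epsilon>. \<bar>\<epsilon>\<bar> * B) \<longlongrightarrow> \<bar>0\<bar> * B) (nhds 0)"
    by (intro tendsto_intros filterlim_ident)
  then have ev: "\<forall>\<^sub>F \<epsilon> in nhds 0. small \<epsilon>"
    unfolding small_def using \<eta>(1) by (simp add: order_tendstoD(2))
  have img: "\<phi> (k u) + \<epsilon> * g u \<in> \<phi> ` ?I" if "small \<epsilon>" "u \<in> sphere 0 1" for \<epsilon> u
  proof (rule \<eta>(2)[OF mR(3)[OF that(2)]])
    have "\<bar>\<epsilon>\<bar> * \<bar>g u\<bar> \<le> \<bar>\<epsilon>\<bar> * B" using B[OF that(2)] by (intro mult_left_mono) auto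
    then show "\<bar>\<epsilon> * g u\<bar> \<le> \<eta>" using that(1) by (simp add: small_def abs_mult)
  qed
  have r: "r \<epsilon> u \<in> ?I" "\<phi> (r \<epsilon> u) = \<phi> (k u) + \<epsilon> * g u" if "small \<epsilon>" "u \<in> sphere 0 1" for \<epsilon> u
    using img[OF that] \<psi> I_pos by (auto simp: r_def)
  have "\<exists>M. is_phi_perturbation \<phi> g \<epsilon> K M" if "small \<epsilon>" for \<epsilon>
  proof -
    have "continuous_on (sphere 0 1) (r \<epsilon>)"
      unfolding r_def using img[OF that] k
      by (intro continuous_on_compose2[OF \<psi>_cont] continuous_intros g continuous_on_compose2[OF \<phi>_cont k(1)]) auto
    moreover have "0 < r \<epsilon> u" if "u \<in> sphere 0 1" for u
      using r(1)[OF \<open>small \<epsilon>\<close> that] by (rule I_pos)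
    ultimately show ?thesis
      using exists_star_body_with_radial_function[of "r \<epsilon>"]
      by (auto simp: is_phi_perturbation_def r_def k_def)
  qed
  moreover have "a < ereal (\<phi> (k u) + \<epsilon> * g u)" if "small \<epsilon>" "u \<in> sphere 0 1" for \<epsilon> u
    using r[OF that] I_pos \<phi> by (metis (mono_tags, lifting) mem_Collect_eq orlicz_J_def)
  ultimately have exist: "\<forall>\<^sub>F \<epsilon> in nhds 0.
           (\<forall>u\<in>sphere 0 1. a < ereal (\<phi> (k u) + \<epsilon> * g u)) \<and> (\<exists>M. is_phi_perturbation \<phi> g \<epsilon> K M)"
    by (intro eventually_mono[OF ev]) blast
  have \<phi>'_cont_I: "continuous_on ?I (\<lambda>t. \<bar>\<phi>' t\<bar>)"
    using I_pos by (intro continuous_intros continuous_on_subset[OF \<phi>'_cont]) auto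
  obtain t0 where t0: "t0 \<in> ?I" "\<And>t. t \<in> ?I \<Longrightarrow> \<bar>\<phi>' t0\<bar> \<le> \<bar>\<phi>' t\<bar>"
    using continuous_attains_inf[OF compact_Icc _ \<phi>'_cont_I] mR by force
  define \<mu> where "\<mu> = \<bar>\<phi>' t0\<bar>"
  have \<mu>: "0 < \<mu>" using \<phi>'_nz I_pos[OF t0(1)] by (simp add: \<mu>_def)
  have expand: "\<mu> * \<bar>s - t\<bar> \<le> \<bar>\<phi> s - \<phi> t\<bar>" if "s \<in> ?I" "t \<in> ?I" for s t
  proof -
    have *: "\<mu> * (y - x) \<le> \<bar>\<phi> y - \<phi> x\<bar>" if xy: "x \<in> ?I" "y \<in> ?I" "x < y" for x y
    proof -
      have "\<exists>z>x. z < y \<and> \<phi> y - \<phi> x = (y - x) * \<phi>' z"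
        by (rule MVT2[OF xy(3)]) (use deriv I_pos[OF xy(1)] in auto)
      then obtain z where z: "x < z" "z < y" "\<phi> y - \<phi> x = (y - x) * \<phi>' z" by blast
      have "\<mu> \<le> \<bar>\<phi>' z\<bar>" unfolding \<mu>_def using z xy by (intro t0(2)) auto
      then show ?thesis using z xy(3) by (simp add: abs_mult mult.commute)
    qed
    consider "s < t" | "s = t" | "t < s" by linarith
    then show ?thesis
    proof cases
      case 1
      then show ?thesis using *[OF that] by (simp add: abs_minus_commute[of s] abs_minus_commute[of "\<phi> s"])
    qed (use *[OF that(2,1)] in simp_all)
  qed
  have "((\<lambda>\<epsilon>. (dual_volume G (M \<epsilon>) - dual_volume G K) / \<epsilon>) \<longlongrightarrow>
             (LINT u:sphere 0 1|hausdorff_measure (CARD('n) - 1). g u * Gt (k u) u / \<phi>' (k u))) (at 0)"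
    if "\<forall>\<^sub>F \<epsilon> in nhds 0. is_phi_perturbation \<phi> g \<epsilon> K (M \<epsilon>)" for M
  proof -
    have pert: "\<forall>\<^sub>F \<epsilon> in at 0. is_phi_perturbation \<phi> g \<epsilon> K (M \<epsilon>)"
      and ev': "\<forall>\<^sub>F \<epsilon> in at 0. small \<epsilon>"
      using that ev by (auto simp: eventually_at_filter elim: eventually_mono)
    have rad: "radial_function (M \<epsilon>) u = r \<epsilon> u"
      if "is_phi_perturbation \<phi> g \<epsilon> K (M \<epsilon>)" "u \<in> sphere 0 1" for \<epsilon> u
      using that by (simp add: is_phi_perturbation_def r_def k_def)
    have "((\<lambda>\<epsilon>. (dual_volume G (M \<epsilon>) - dual_volume G K) / \<epsilon>) \<longlongrightarrow>
        (LINT u:sphere 0 1|hausdorff_measure (CARD('n) - 1).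
           g u / \<phi>' (k u) * Gt (radial_function K u) u)) (at 0)"
    proof (rule dual_volume_first_variation[OF G_cont Gt_deriv Gt_cont K, where C="B / \<mu>"])
      show "\<forall>\<^sub>F \<epsilon> in at 0. M \<epsilon> \<in> star_bodies"
        using pert by eventually_elim (simp add: is_phi_perturbation_def)
      show "continuous_on (sphere 0 1) (\<lambda>u. g u / \<phi>' (k u))"
        using k \<phi>'_nz by (intro continuous_intros g continuous_on_compose2[OF \<phi>'_cont k(1)]) auto
      show "\<forall>\<^sub>F \<epsilon> in at 0. \<forall>u\<in>sphere 0 1.
          \<bar>radial_function (M \<epsilon>) u - radial_function K u\<bar> \<le> B / \<mu> * \<bar>\<epsilon>\<bar>"
        using pert ev'
      proof eventually_elim
        case (elim \<epsilon>)
        show ?case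
        proof
          fix u :: "real ^ 'n" assume u: "u \<in> sphere 0 1"
          have "k u \<in> ?I" using mR(1,2) mR(3)[OF u] by auto
          from expand[OF r(1)[OF elim(2) u] this] have "\<mu> * \<bar>r \<epsilon> u - k u\<bar> \<le> \<bar>\<epsilon>\<bar> * \<bar>g u\<bar>"
            using r(2)[OF elim(2) u] by (simp add: abs_mult)
          also have "\<dots> \<le> \<bar>\<epsilon>\<bar> * B" using B[OF u] by (intro mult_left_mono) auto
          finally show "\<bar>radial_function (M \<epsilon>) u - radial_function K u\<bar> \<le> B / \<mu> * \<bar>\<epsilon>\<bar>"
            using \<mu> rad[OF elim(1) u] by (simp add: k_def field_simps)
        qed
      qed
      show "((\<lambda>\<epsilon>. (radial_function (M \<epsilon>) u - radial_function K u) / \<epsilon>) \<longlongrightarrow> g u / \<phi>' (k u)) (at 0)"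
        if u: "u \<in> sphere 0 1" for u
      proof -
        have "(?\<psi> has_real_derivative inverse (\<phi>' (k u))) (at (\<phi> (k u)))"
          unfolding has_field_derivative_def
        proof (rule has_derivative_inverse_strong[where S="{0<..}" and f=\<phi> and f'="(*) (\<phi>' (k u))"])
          show "(\<phi> has_derivative (*) (\<phi>' (k u))) (at (k u))"
            using deriv k(2)[OF u] by (simp add: has_field_derivative_def)
          show "(*) (\<phi>' (k u)) \<circ> (*) (inverse (\<phi>' (k u))) = id"
            using \<phi>'_nz k(2)[OF u] by (simp add: fun_eq_iff)
        qed (use k(2)[OF u] \<psi> \<phi>_cont in auto)
        then have "(?\<psi> has_real_derivative inverse (\<phi>' (k u))) (at (\<phi> (k u) + 0 * g u))"
          by simp
        moreover have "((\<lambda>\<epsilon>. \<phi> (k u) + \<epsilon> * g u) has_real_derivative g u) (at 0)"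
          by (auto intro!: derivative_eq_intros)
        ultimately have "((\<lambda>\<epsilon>. r \<epsilon> u) has_real_derivative inverse (\<phi>' (k u)) * g u) (at 0)"
          unfolding r_def by (rule DERIV_chain2)
        then have "((\<lambda>\<epsilon>. (r \<epsilon> u - r 0 u) / (\<epsilon> - 0)) \<longlongrightarrow> inverse (\<phi>' (k u)) * g u) (at 0)"
          by (simp only: has_field_derivative_iff)
        then have "((\<lambda>\<epsilon>. (radial_function (M \<epsilon>) u - radial_function K u) / \<epsilon>) \<longlongrightarrow>
            inverse (\<phi>' (k u)) * g u) (at 0)"
        proof (rule Lim_transform_eventually)
          have "r 0 u = radial_function K u" using k(2)[OF u] by (simp add: r_def \<psi> k_def)
          then show "\<forall>\<^sub>F \<epsilon> in at 0. (r \<epsilon> u - r 0 u) / (\<epsilon> - 0)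
              = (radial_function (M \<epsilon>) u - radial_function K u) / \<epsilon>"
            by (intro eventually_mono[OF pert]) (simp add: rad[OF _ u])
        qed
        then show ?thesis by (simp add: divide_inverse mult.commute)
      qed
    qed
    then show ?thesis by (simp add: k_def)
  qed
  then show ?thesis using exist unfolding k_def by blast
qed

section \<open>The variational formulas\<close>

theorem theorem4p1:
  fixes G Gt :: "real \<Rightarrow> real ^ 'n \<Rightarrow> real" and K L :: "(real ^ 'n) set"
  assumes G_pos: "\<And>t u. 0 < t \<Longrightarrow> u \<in> sphere 0 1 \<Longrightarrow> 0 < G t u"
    and G_cont: "continuous_on ({0<..} \<times> sphere 0 1) (\<lambda>(t, u). G t u)"
    and Gt_deriv: "\<And>t u. 0 < t \<Longrightarrow> u \<in> sphere 0 1 \<Longrightarrow>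
          ((\<lambda>s. G s u) has_real_derivative Gt t u) (at t)"
    and Gt_cont: "continuous_on ({0<..} \<times> sphere 0 1) (\<lambda>(t, u). Gt t u)"
    and K: "K \<in> star_bodies"
    and L: "L \<in> star_bodies"
  shows
    "(\<forall>\<phi>1\<in>orlicz_I. \<forall>\<phi>2\<in>orlicz_I. \<forall>d.
        (\<phi>1 has_real_derivative d) (at_left 1) \<and> 0 < d \<longrightarrow>
        (\<forall>\<epsilon>>0. (\<forall>u\<in>sphere 0 1. \<exists>!r. 0 < r \<and> orlicz_equation \<phi>1 \<phi>2 \<epsilon> K L u r) \<and>
                 (\<exists>M. is_orlicz_combination \<phi>1 \<phi>2 \<epsilon> K L M)) \<and>
        (\<forall>K\<epsilon>. (\<forall>\<epsilon>>0. is_orlicz_combination \<phi>1 \<phi>2 \<epsilon> K L (K\<epsilon> \<epsilon>)) \<longrightarrow>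
          ((\<lambda>\<epsilon>. (dual_volume G (K\<epsilon> \<epsilon>) - dual_volume G K) / \<epsilon>) \<longlongrightarrow>
             1 / d * (LINT u:sphere 0 1|hausdorff_measure (CARD('n) - 1).
               \<phi>2 (radial_function L u / radial_function K u) * radial_function K u
                 * Gt (radial_function K u) u)) (at_right 0)))
   \<and> (\<forall>\<phi>1\<in>orlicz_D. \<forall>\<phi>2\<in>orlicz_D. \<forall>d.
        (\<phi>1 has_real_derivative d) (at_right 1) \<and> d < 0 \<longrightarrow>
        (\<forall>\<epsilon>>0. (\<forall>u\<in>sphere 0 1. \<exists>!r. 0 < r \<and> orlicz_equation \<phi>1 \<phi>2 \<epsilon> K L u r) \<and>
                 (\<exists>M. is_orlicz_combination \<phi>1 \<phi>2 \<epsilon> K L M)) \<and>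
        (\<forall>K\<epsilon>. (\<forall>\<epsilon>>0. is_orlicz_combination \<phi>1 \<phi>2 \<epsilon> K L (K\<epsilon> \<epsilon>)) \<longrightarrow>
          ((\<lambda>\<epsilon>. (dual_volume G (K\<epsilon> \<epsilon>) - dual_volume G K) / \<epsilon>) \<longlongrightarrow>
             1 / d * (LINT u:sphere 0 1|hausdorff_measure (CARD('n) - 1).
               \<phi>2 (radial_function L u / radial_function K u) * radial_function K u
                 * Gt (radial_function K u) u)) (at_right 0)))
   \<and> (\<forall>a \<phi> \<phi>' g.
        a \<noteq> \<infinity> \<and> \<phi> \<in> orlicz_J a \<and>
        (\<forall>t>0. (\<phi> has_real_derivative \<phi>' t) (at t)) \<and>
        continuous_on {0<..} \<phi>' \<and> (\<forall>t>0. \<phi>' t \<noteq> 0) \<and>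
        continuous_on (sphere 0 1) g \<longrightarrow>
        (\<forall>\<^sub>F \<epsilon> in nhds 0.
           (\<forall>u\<in>sphere 0 1. a < ereal (\<phi> (radial_function K u) + \<epsilon> * g u)) \<and>
           (\<exists>M. is_phi_perturbation \<phi> g \<epsilon> K M)) \<and>
        (\<forall>K\<epsilon>. (\<forall>\<^sub>F \<epsilon> in nhds 0. is_phi_perturbation \<phi> g \<epsilon> K (K\<epsilon> \<epsilon>)) \<longrightarrow>
          ((\<lambda>\<epsilon>. (dual_volume G (K\<epsilon> \<epsilon>) - dual_volume G K) / \<epsilon>) \<longlongrightarrow>
             (LINT u:sphere 0 1|hausdorff_measure (CARD('n) - 1).
               g u * Gt (radial_function K u) u / \<phi>' (radial_function K u))) (at 0)))"
proof ((intro conjI[OF _ conjI]; intro ballI allI impI), goal_cases)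
  case (1 \<phi>1 \<phi>2 d)
  then obtain X where X: "solution_branch \<phi>1 \<phi>2 d X"
    using solution_branch_exists_I by blast
  show ?case
    by (rule dual_volume_orlicz_variation[OF G_cont Gt_deriv Gt_cont K L X])
      (use 1 in \<open>auto simp: orlicz_I_def\<close>)
next
  case (2 \<phi>1 \<phi>2 d)
  then obtain X where X: "solution_branch \<phi>1 \<phi>2 d X"
    using solution_branch_exists_D by blast
  show ?case
    by (rule dual_volume_orlicz_variation[OF G_cont Gt_deriv Gt_cont K L X])
      (use 2 in \<open>auto simp: orlicz_D_def\<close>)
next
  case (3 a \<phi> \<phi>' g)
  then show ?case
    by (intro dual_volume_phi_variation[OF G_cont Gt_deriv Gt_cont K, where a=a]) auto
qed

end
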